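(* Let $d \ge 2$, let $a \in \mathbb{R}^d$ with $a \neq 0$, let $\sigma_X^2, \sigma_Y^2 > 0$, and let $\mathcal{L}_1, \mathcal{L}_2$ be cdfs on $\mathbb{R}$, all known. For unknown $\theta \in \mathbb{R}^d$, let $X|\theta \sim MMN_d(\theta, a, \sigma_X^2 I_d, \mathcal{L}_1)$ and $Y|\theta \sim MMN_d(\theta, a, \sigma_Y^2 I_d, \mathcal{L}_2)$ be independently distributed. Let $H = \begin{pmatrix} h_1^{\top} \\ H_2 \end{pmatrix}$ be a $d \times d$ orthogonal matrix with $h_1 = a/\|a\|$, and put $\zeta_{(2)} = H_2\theta \in \mathbb{R}^{d-1}$. Let $C \subsetneq \mathbb{R}^{d-1}$ be a convex set with non-empty interior, and let $\pi_C(\theta) = I_C(\zeta_{(2)}) = I_C(H_2\theta)$ (prior density with respect to Lebesgue measure on $\mathbb{R}^d$). Then the Bayes predictive density $\hat{q}_{\pi_C}(\cdot;X)$ dominates the minimum risk equivariant (MRE) predictive density $\hat{q}_U(\cdot;X)$ under Kullback-Leibler risk and the restriction $\theta \in \{\theta \in \mathbb{R}^d : H_2\theta \in C\}$.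
   Context: A random vector $X \in \mathbb{R}^d$ has a mean-mixture of normal distributions, written $X \sim MMN_d(\theta, a, \Sigma, \mathcal{L})$, if $X|V=v \sim N_d(\theta + v a, \Sigma)$ with $V \sim \mathcal{L}$, where $\theta\in\mathbb{R}^d$ is a location parameter, $a \in \mathbb{R}^d$ a perturbation vector, $\Sigma$ a positive definite matrix, and $V$ a scalar random variable with cdf $\mathcal{L}$. $I_C$ is the indicator function of $C$. Let $p(\cdot|\theta)$, $q(\cdot|\theta)$ denote the conditional densities of $X$ and $Y$ given $\theta$. The Bayes predictive density for a prior density $\pi$ is $\hat{q}_\pi(y;x) = \int q(y|\theta)\,\pi(\theta|x)\,d\theta$, where $\pi(\theta|x) = p(x|\theta)\pi(\theta)/\int p(x|t)\pi(t)\,dt$. The MRE predictive density $\hat{q}_U$ (for the unrestricted problem) is the Bayes predictive density for the uniform prior $\pi_U(\theta)=1$ on $\mathbb{R}^d$; here it is the $MMN_d(X,a,(\sigma_X^2+\sigma_Y^2)I_d,\mathcal{L}_3)$ density, with $\mathcal{L}_3$ the cdf of $V_2-V_1$ for independent $V_1\sim\mathcal{L}_1$, $V_2\sim\mathcal{L}_2$. The Kullback-Leibler risk is $R_{KL}(\theta,\hat{q}) = \int_{\mathbb{R}^d} \left\{ \int_{\mathbb{R}^d} q(y|\theta) \log \frac{q(y|\theta)}{\hat{q}(y;x)}\, dy \right\} p(x|\theta)\, dx$. Dominance under a parametric restriction means that the risk is less than or equal to that of the competitor for all $\theta$ in the restricted parameter space, with strict inequality for at least one such $\theta$.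
   Formalization: The formal theorem additionally assumes that the Kullback-Leibler risk of the MRE density is finite at some θ; for some mixing cdfs this risk is infinite, both risks are then identically infinite, and strict inequality fails. *)

theory Defs
  imports "HOL-Probability.Probability"
begin

section \<open>Normal distributions and their mean mixtures\<close>

definition is_cdf :: "(real \<Rightarrow> real) \<Rightarrow> bool" where
  "is_cdf F \<longleftrightarrow> mono F \<and> (\<forall>x. continuous (at_right x) F) \<and>
     (F \<longlongrightarrow> 0) at_bot \<and> (F \<longlongrightarrow> 1) at_top"

definition mvn_density :: "real^'n \<Rightarrow> real^'n^'n \<Rightarrow> real^'n \<Rightarrow> real" where
  "mvn_density \<mu> \<Sigma> x =
     exp (- ((x - \<mu>) \<bullet> (matrix_inv \<Sigma> *v (x - \<mu>))) / 2) / sqrt ((2 * pi) ^ CARD('n) * det \<Sigma>)"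

definition mvn :: "real^'n \<Rightarrow> real^'n^'n \<Rightarrow> (real^'n) measure" where
  "mvn \<mu> \<Sigma> = density lborel (\<lambda>x. ennreal (mvn_density \<mu> \<Sigma> x))"

text \<open>
  The law of \<open>X\<close> in the hierarchical model \<open>V \<sim> L\<close>, \<open>X | V = v \<sim> N(\<theta> + v a, \<Sigma>)\<close>.
  The measure with cdf \<open>L\<close> is \<^term>\<open>interval_measure L\<close>.
\<close>

definition MMN :: "real^'n \<Rightarrow> real^'n \<Rightarrow> real^'n^'n \<Rightarrow> (real \<Rightarrow> real) \<Rightarrow> (real^'n) measure" where
  "MMN \<theta> a \<Sigma> L = interval_measure L \<bind> (\<lambda>v. mvn (\<theta> + v *\<^sub>R a) \<Sigma>)"

definition MMN_density ::
  "real^'n \<Rightarrow> real^'n \<Rightarrow> real^'n^'n \<Rightarrow> (real \<Rightarrow> real) \<Rightarrow> real^'n \<Rightarrow> real" where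
  "MMN_density \<theta> a \<Sigma> L x = (\<integral>v. mvn_density (\<theta> + v *\<^sub>R a) \<Sigma> x \<partial>interval_measure L)"

lemma is_cdf_real_distribution:
  assumes "is_cdf L"
  shows "real_distribution (interval_measure L)" "cdf (interval_measure L) = L"
  using assms unfolding is_cdf_def mono_def
  by (auto intro!: real_distribution_interval_measure cdf_interval_measure)

lemma mat_mult_mat:
  fixes s t :: real
  shows "mat s ** mat t = (mat (s * t) :: real^'n^'n)"
proof -
  have "(\<Sum>k\<in>UNIV. (if i = k then s else 0) * (if k = j then t else 0)) = (if i = j then s * t else 0)" for i j :: 'n
    by (subst sum.remove[of _ i]) (auto intro!: sum.neutral)
  then show ?thesis
    by (simp add: vec_eq_iff matrix_matrix_mult_def mat_def)
qed

lemma matrix_inv_mat: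
  fixes s :: real
  assumes "s \<noteq> 0"
  shows "matrix_inv (mat s :: real^'n^'n) = mat (1 / s)"
proof -
  have prod: "mat s ** (mat (1/s)) = (mat 1 :: real^'n^'n)" "mat (1/s) ** mat s = (mat 1 :: real^'n^'n)"
    using assms by (simp_all add: mat_mult_mat)
  then have "mat s ** matrix_inv (mat s) = (mat 1 :: real^'n^'n)"
    unfolding matrix_inv_def by (metis (mono_tags, lifting) someI_ex)
  then have "mat (1/s) ** (mat s ** matrix_inv (mat s)) = (mat (1/s) :: real^'n^'n)"
    by simp
  then show ?thesis
    by (simp add: matrix_mul_assoc prod)
qed

lemma mvn_density_mat:
  fixes \<mu> x :: "real^'n"
  assumes "s > 0"
  shows "mvn_density \<mu> (mat s) x = (\<Prod>i\<in>UNIV. normal_density (\<mu> $ i) (sqrt s) (x $ i))"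
proof -
  have det: "det (mat s :: real^'n^'n) = s ^ CARD('n)"
    by (subst det_diagonal) (auto simp: mat_def)
  have inv: "matrix_inv (mat s :: real^'n^'n) *v z = (1 / s) *\<^sub>R z" for z
    unfolding matrix_inv_mat[OF less_imp_neq[OF assms, symmetric]]
    by (simp add: vec_eq_iff matrix_vector_mult_def mat_def if_distrib if_distribR cong: if_cong)
  have "(\<Prod>i\<in>UNIV. normal_density (\<mu> $ i) (sqrt s) (x $ i)) =
      (\<Prod>i\<in>(UNIV::'n set). 1 / sqrt (2 * pi * s)) * exp (\<Sum>i\<in>UNIV. - (x $ i - \<mu> $ i)\<^sup>2 / (2 * s))"
    unfolding exp_sum[OF finite] prod.distrib[symmetric]
    by (rule prod.cong) (use assms in \<open>simp_all add: normal_density_def\<close>)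
  also have "(\<Prod>i\<in>(UNIV::'n set). 1 / sqrt (2 * pi * s)) = 1 / sqrt ((2 * pi) ^ CARD('n) * s ^ CARD('n))"
    by (simp add: power_divide real_sqrt_power[symmetric] power_mult_distrib)
  also have "(\<Sum>i\<in>UNIV. - (x $ i - \<mu> $ i)\<^sup>2 / (2 * s)) = - ((x - \<mu>) \<bullet> ((1 / s) *\<^sub>R (x - \<mu>))) / 2"
    by (simp add: inner_vec_def power2_eq_square sum_negf flip: sum_divide_distrib)
  finally show ?thesis
    by (simp add: mvn_density_def det inv)
qed

lemma mvn_density_mat_pos: "s > 0 \<Longrightarrow> 0 < mvn_density \<mu> (mat s) x"
  by (simp add: mvn_density_mat prod_pos normal_density_pos)

lemma mvn_density_mat_measurable:
  fixes f g :: "'b \<Rightarrow> real^'n"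
  assumes "s > 0" and [measurable]: "f \<in> borel_measurable M" "g \<in> borel_measurable M"
  shows "(\<lambda>w. mvn_density (f w) (mat s) (g w)) \<in> borel_measurable M"
proof -
  have "(\<lambda>z::real^'n. z $ i) \<in> borel_measurable borel" for i
    by (intro borel_measurable_continuous_onI continuous_on_component continuous_on_id)
  from measurable_compose[OF assms(2) this] measurable_compose[OF assms(3) this]
  have [measurable]: "(\<lambda>w. f w $ i) \<in> borel_measurable M" "(\<lambda>w. g w $ i) \<in> borel_measurable M" for i
    by simp_all
  show ?thesis
    unfolding mvn_density_mat[OF \<open>s > 0\<close>] normal_density_def by measurable
qed

lemma prob_space_mvn_mat:
  fixes \<mu> :: "real^'n"
  assumes "s > 0"
  shows "prob_space (mvn \<mu> (mat s))"
proof
  let ?f = "\<lambda>(b::real^'n) x. ennreal (normal_density (\<mu> \<bullet> b) (sqrt s) x)"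
  have Basis: "(Basis :: (real^'n) set) = (\<lambda>i. axis i 1) ` UNIV"
    by (auto simp: Basis_vec_def)
  have inj: "inj (\<lambda>i::'n. axis i (1::real))"
    by (auto simp: inj_on_def axis_eq_axis)
  have "ennreal (mvn_density \<mu> (mat s) x) = (\<Prod>b\<in>Basis. ?f b (x \<bullet> b))" for x
    using assms
    by (simp add: mvn_density_mat prod_ennreal Basis prod.reindex[OF inj] inner_axis)
  then have "(\<integral>\<^sup>+x. ennreal (mvn_density \<mu> (mat s) x) \<partial>lborel) =
      (\<integral>\<^sup>+x. (\<Prod>b\<in>Basis. ?f b (x \<bullet> b)) \<partial>lborel)"
    by simp
  also have "\<dots> = (\<Prod>b\<in>Basis. (\<integral>\<^sup>+x. ?f b x \<partial>lborel))"
    by (rule nn_integral_lborel_prod) auto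
  also have "\<dots> = 1"
    using assms by (simp add: nn_integral_eq_integral)
  finally show "emeasure (mvn \<mu> (mat s)) (space (mvn \<mu> (mat s))) = 1"
    using mvn_density_mat_measurable[OF assms, of "\<lambda>_. \<mu>" lborel "\<lambda>x. x"]
    by (simp add: mvn_def emeasure_density)
qed

lemma MMN_eq_density:
  fixes \<theta> a :: "real^'n"
  assumes "is_cdf L" "s > 0"
  shows "MMN \<theta> a (mat s) L = density lborel (\<lambda>x. ennreal (MMN_density \<theta> a (mat s) L x))"
    and "MMN_density \<theta> a (mat s) L \<in> borel_measurable borel"
proof -
  interpret real_distribution "interval_measure L"
    using assms by (intro is_cdf_real_distribution)
  note mvn_density_mat_measurable[OF \<open>s > 0\<close>, measurable]
  let ?\<phi> = "\<lambda>v x. mvn_density (\<theta> + v *\<^sub>R a) (mat s) x"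
  have nn: "0 \<le> ?\<phi> v x" for v x
    using mvn_density_mat_pos[OF \<open>s > 0\<close>] by (rule less_imp_le)
  show meas[measurable]: "MMN_density \<theta> a (mat s) L \<in> borel_measurable borel"
    unfolding MMN_density_def by measurable
  have kernel: "(\<lambda>v. mvn (\<theta> + v *\<^sub>R a) (mat s)) \<in> measurable (interval_measure L) (subprob_algebra borel)"
  proof (rule measurable_subprob_algebra)
    show "subprob_space (mvn (\<theta> + v *\<^sub>R a) (mat s))" for v
      using prob_space_mvn_mat[OF \<open>s > 0\<close>] by (rule prob_space_imp_subprob_space)
    show "sets (mvn (\<theta> + v *\<^sub>R a) (mat s)) = sets borel" for v
      by (simp add: mvn_def)
    show "(\<lambda>v. emeasure (mvn (\<theta> + v *\<^sub>R a) (mat s)) A) \<in> borel_measurable (interval_measure L)"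
      if [measurable]: "A \<in> sets borel" for A
      by (simp add: mvn_def emeasure_density)
  qed
  have bound: "?\<phi> v x \<le> 1 / sqrt (2 * pi * s) ^ CARD('n)" for v x
  proof -
    have "?\<phi> v x \<le> (\<Prod>i\<in>(UNIV::'n set). 1 / sqrt (2 * pi * s))"
      unfolding mvn_density_mat[OF \<open>s > 0\<close>]
      by (intro prod_mono) (use \<open>s > 0\<close> in \<open>auto simp: normal_density_def divide_right_mono\<close>)
    then show ?thesis by (simp add: power_divide)
  qed
  have int: "integrable (interval_measure L) (\<lambda>v. ?\<phi> v x)" for x
    by (rule integrable_const_bound[where B = "1 / sqrt (2 * pi * s) ^ CARD('n)"])
       (use bound nn in auto)
  have eq: "ennreal (MMN_density \<theta> a (mat s) L x) = (\<integral>\<^sup>+v. ennreal (?\<phi> v x) \<partial>interval_measure L)" for x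
    unfolding MMN_density_def by (rule nn_integral_eq_integral[symmetric, OF int]) (simp add: nn)
  show "MMN \<theta> a (mat s) L = density lborel (\<lambda>x. ennreal (MMN_density \<theta> a (mat s) L x))"
  proof (rule measure_eqI)
    show "sets (MMN \<theta> a (mat s) L) = sets (density lborel (\<lambda>x. ennreal (MMN_density \<theta> a (mat s) L x)))"
      unfolding MMN_def by (subst sets_bind[where N = borel]) (simp_all add: mvn_def)
    fix A assume "A \<in> sets (MMN \<theta> a (mat s) L)"
    then have A[measurable]: "A \<in> sets borel"
      unfolding MMN_def by (subst (asm) sets_bind[where N = borel]) (simp_all add: mvn_def)
    interpret P: pair_sigma_finite "interval_measure L" lborel ..
    have "emeasure (MMN \<theta> a (mat s) L) A = (\<integral>\<^sup>+v. emeasure (mvn (\<theta> + v *\<^sub>R a) (mat s)) A \<partial>interval_measure L)"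
      unfolding MMN_def by (rule emeasure_bind[OF _ kernel A]) simp
    also have "\<dots> = (\<integral>\<^sup>+v. (\<integral>\<^sup>+x. ennreal (?\<phi> v x) * indicator A x \<partial>lborel) \<partial>interval_measure L)"
      by (simp add: mvn_def emeasure_density)
    also have "\<dots> = (\<integral>\<^sup>+x. (\<integral>\<^sup>+v. ennreal (?\<phi> v x) * indicator A x \<partial>interval_measure L) \<partial>lborel)"
      by (rule P.Fubini'[symmetric]) measurable
    also have "\<dots> = (\<integral>\<^sup>+x. ennreal (MMN_density \<theta> a (mat s) L x) * indicator A x \<partial>lborel)"
      by (simp add: eq nn_integral_multc)
    also have "\<dots> = emeasure (density lborel (\<lambda>x. ennreal (MMN_density \<theta> a (mat s) L x))) A"
      by (simp add: emeasure_density)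
    finally show "emeasure (MMN \<theta> a (mat s) L) A =
        emeasure (density lborel (\<lambda>x. ennreal (MMN_density \<theta> a (mat s) L x))) A" .
  qed
qed


section \<open>Predictive densities and Kullback-Leibler risk\<close>

text \<open>
  Integrals are over \<^term>\<open>lebesgue\<close> rather than \<^term>\<open>lborel\<close>: the indicator of a convex set
  is a prior density that need not be Borel measurable.
\<close>

definition posterior ::
  "('t::euclidean_space \<Rightarrow> 'x \<Rightarrow> real) \<Rightarrow> ('t \<Rightarrow> real) \<Rightarrow> 'x \<Rightarrow> 't \<Rightarrow> real" where
  "posterior p \<pi> x \<theta> = p \<theta> x * \<pi> \<theta> / (\<integral>t. p t x * \<pi> t \<partial>lebesgue)"

text \<open>A predictive density \<open>qhat\<close> is applied to the observed \<open>x\<close> first: \<open>qhat x y\<close> is \<open>qhat(y; x)\<close>.\<close>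

definition bayes_predictive ::
  "('t::euclidean_space \<Rightarrow> 'x \<Rightarrow> real) \<Rightarrow> ('t \<Rightarrow> 'y \<Rightarrow> real) \<Rightarrow> ('t \<Rightarrow> real) \<Rightarrow> 'x \<Rightarrow> 'y \<Rightarrow> real" where
  "bayes_predictive p q \<pi> x y = (\<integral>\<theta>. q \<theta> y * posterior p \<pi> x \<theta> \<partial>lebesgue)"

definition mre_predictive ::
  "('t::euclidean_space \<Rightarrow> 'x \<Rightarrow> real) \<Rightarrow> ('t \<Rightarrow> 'y \<Rightarrow> real) \<Rightarrow> 'x \<Rightarrow> 'y \<Rightarrow> real" where
  "mre_predictive p q = bayes_predictive p q (\<lambda>\<theta>. 1)"

text \<open>
  The Bochner integral is 0 on non-integrable functions, which would turn an infinite risk into 0;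
  risks are therefore computed with the extended-real Lebesgue integral (positive part minus
  negative part).
\<close>

definition ext_integral :: "'a measure \<Rightarrow> ('a \<Rightarrow> ereal) \<Rightarrow> ereal" where
  "ext_integral M f =
     enn2ereal (\<integral>\<^sup>+x. e2ennreal (f x) \<partial>M) - enn2ereal (\<integral>\<^sup>+x. e2ennreal (- f x) \<partial>M)"

lemma ext_integral_eq_integral:
  assumes "integrable M f"
  shows "ext_integral M (\<lambda>x. ereal (f x)) = ereal (integral\<^sup>L M f)"
proof -
  have fin: "(\<integral>\<^sup>+x. ennreal (f x) \<partial>M) < \<infinity>" "(\<integral>\<^sup>+x. ennreal (- f x) \<partial>M) < \<infinity>"
    using assms by (auto simp: real_integrable_def top.not_eq_extremum)
  have "enn2ereal u = ereal (enn2real u)" if "u < \<infinity>" for u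
    using that by (cases u) (auto simp: ennreal.rep_eq)
  then show ?thesis
    using fin assms
    by (simp add: ext_integral_def real_lebesgue_integral_def flip: ennreal.abs_eq)
qed

text \<open>
  The negative part of the inner integrand is at most \<open>qhat x y\<close> and hence integrable when \<open>qhat x\<close> is
  a density, so no difference of infinities occurs. The formula presupposes \<open>q \<theta> y > 0\<close> and
  \<open>qhat x y > 0\<close>, which holds for mean mixtures of normals and their Bayes predictive densities.
\<close>

definition KL_risk ::
  "('t \<Rightarrow> 'x::euclidean_space \<Rightarrow> real) \<Rightarrow> ('t \<Rightarrow> 'y::euclidean_space \<Rightarrow> real) \<Rightarrow>
     't \<Rightarrow> ('x \<Rightarrow> 'y \<Rightarrow> real) \<Rightarrow> ereal" where
  "KL_risk p q \<theta> qhat =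
     ext_integral lebesgue (\<lambda>x.
       ext_integral lebesgue (\<lambda>y. ereal (q \<theta> y * ln (q \<theta> y / qhat x y))) * ereal (p \<theta> x))"

definition dominates_on ::
  "'t set \<Rightarrow> ('t \<Rightarrow> 'e \<Rightarrow> ereal) \<Rightarrow> 'e \<Rightarrow> 'e \<Rightarrow> bool" where
  "dominates_on \<Theta> R e1 e2 \<longleftrightarrow>
     (\<forall>\<theta>\<in>\<Theta>. R \<theta> e1 \<le> R \<theta> e2) \<and> (\<exists>\<theta>\<in>\<Theta>. R \<theta> e1 < R \<theta> e2)"

end

theory Submission
  imports Defs
begin

text \<open>
  Let \<open>S\<close> be the set of parameters \<open>\<theta>\<close> with \<open>H2 *v \<theta> \<in> C\<close>. Since the rows of \<open>H2\<close> are orthogonal to \<open>a\<close>,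
  \<open>S\<close> is a convex set that is invariant under translations along \<open>a\<close>, and the argument can be carried out
  with \<open>S\<close> in place of \<open>C\<close>, without passing to the rotated coordinates.

  Write \<open>s\<close>, \<open>t\<close> for the variances of \<open>X\<close>, \<open>Y\<close> without the mixing, \<open>r = s t / (s + t)\<close>, \<open>m = (t x + s y) / (s + t)\<close>, and \<open>u\<^sub>s(x)\<close> for the
  probability of \<open>S\<close> under \<open>N(x, s I)\<close>. Completing the square and using the invariance of \<open>S\<close> shows that the
  Bayes predictive density of the prior \<open>1\<^sub>S\<close> is \<open>h(y - x) u\<^sub>r(m) / u\<^sub>s(x)\<close>, where \<open>h(y - x)\<close> is the MRE density
  (\<open>bayes_predictive_indicator\<close>). The risks therefore differ by the expectation of
  \<open>ln u\<^sub>r(m) - ln u\<^sub>s(x)\<close>. This function is constant along \<open>a\<close>, so the mixing variables have no influence on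
  the expectation, and \<open>m\<close> may be taken to have the law \<open>N(\<theta>, r I)\<close>. With
  \<open>F(s) = E (- ln u\<^sub>s(\<theta> + sqrt s Z))\<close> for a standard normal \<open>Z\<close>, the gain in risk is \<open>F(s) - F(r)\<close>, where
  \<open>r < s\<close> (\<open>KL_risk_bayes_indicator\<close>).

  Finally \<open>u\<^sub>s(\<theta> + sqrt s z)\<close> is the probability that a standard normal vector centred at \<open>z\<close> falls into
  \<open>(S - \<theta>) / sqrt s\<close>. For \<open>\<theta> \<in> S\<close> these sets decrease in \<open>s\<close>, because \<open>S\<close> is star-shaped about \<open>\<theta>\<close>; so
  \<open>F\<close> is increasing (\<open>log_loss_mono\<close>). For \<open>\<theta>\<close> in the interior of \<open>S\<close> two of these sets differ by a set with
  nonempty interior, because \<open>S\<close> is not the whole space; so \<open>F\<close> increases strictly (\<open>log_loss_strict_mono\<close>).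
  The gain is finite since \<open>- ln u\<^sub>s\<close> grows at most quadratically. Strict inequality of the risks needs a finite
  risk of the MRE density at some interior \<open>\<theta>\<close>; as that risk is constant in \<open>\<theta>\<close>
  (\<open>KL_risk_mre_constant\<close>), finiteness at one parameter is enough.
\<close>

section \<open>Isotropic Gaussian kernels\<close>

lemma nn_integral_lborel_shift:
  fixes c :: "'a::euclidean_space"
  assumes [measurable]: "f \<in> borel_measurable borel"
  shows "(\<integral>\<^sup>+x. f (x + c) \<partial>lborel) = (\<integral>\<^sup>+x. f x \<partial>lborel)"
proof -
  have "(\<integral>\<^sup>+x. f x \<partial>lborel) = (\<integral>\<^sup>+x. f x \<partial>distr lborel borel ((+) c))"
    by (simp add: lborel_distr_plus)
  also have "\<dots> = (\<integral>\<^sup>+x. f (x + c) \<partial>lborel)"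
    by (subst nn_integral_distr) (auto simp: add.commute)
  finally show ?thesis ..
qed

lemma nn_integral_lborel_affine:
  fixes t :: "'a::euclidean_space"
  assumes [measurable]: "f \<in> borel_measurable borel" and "c \<noteq> 0"
  shows "(\<integral>\<^sup>+x. f x \<partial>lborel) = ennreal (\<bar>c\<bar> ^ DIM('a)) * (\<integral>\<^sup>+x. f (t + c *\<^sub>R x) \<partial>lborel)"
  by (subst lborel_affine[OF \<open>c \<noteq> 0\<close>, of t])
     (simp add: nn_integral_density nn_integral_distr nn_integral_cmult ennreal_power)

definition gauss :: "real \<Rightarrow> real^'n \<Rightarrow> real" where
  "gauss s z = exp (- (norm z)\<^sup>2 / (2 * s)) / sqrt ((2 * pi * s) ^ CARD('n))"

lemma gauss_measurable [measurable]: "gauss s \<in> borel_measurable borel"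
  unfolding gauss_def by measurable

lemma gauss_pos: "s > 0 \<Longrightarrow> 0 < gauss s z"
  by (simp add: gauss_def)

lemma gauss_nonneg: "s > 0 \<Longrightarrow> 0 \<le> gauss s z"
  by (simp add: gauss_def)

lemma gauss_le: "s > 0 \<Longrightarrow> gauss s (z::real^'n) \<le> 1 / sqrt ((2 * pi * s) ^ CARD('n))"
  unfolding gauss_def by (intro divide_right_mono) auto

lemma gauss_minus [simp]: "gauss s (- z) = gauss s z"
  by (simp add: gauss_def)

lemma mvn_density_eq_gauss:
  fixes \<mu> x :: "real^'n"
  assumes "s > 0"
  shows "mvn_density \<mu> (mat s) x = gauss s (x - \<mu>)"
proof -
  have det: "det (mat s :: real^'n^'n) = s ^ CARD('n)"
    by (subst det_diagonal) (auto simp: mat_def)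
  have inv: "matrix_inv (mat s :: real^'n^'n) *v z = (1 / s) *\<^sub>R z" for z
    unfolding matrix_inv_mat[OF less_imp_neq[OF assms, symmetric]]
    by (simp add: vec_eq_iff matrix_vector_mult_def mat_def if_distrib if_distribR cong: if_cong)
  show ?thesis
    by (simp add: mvn_density_def gauss_def det inv power_mult_distrib power2_norm_eq_inner)
qed

lemma nn_integral_gauss:
  assumes "s > 0"
  shows "(\<integral>\<^sup>+z. ennreal (gauss s (z - x :: real^'n)) \<partial>lborel) = 1"
proof -
  interpret prob_space "mvn x (mat s)" by (rule prob_space_mvn_mat[OF assms])
  show ?thesis
    using emeasure_space_1 assms by (simp add: mvn_def mvn_density_eq_gauss emeasure_density)
qed

text \<open>
  Completing the square in \<open>z\<close>: the product of the two Gaussian likelihoods of a common centre splits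
  into a factor free of the centre and a likelihood for the precision-weighted mean.
\<close>

lemma gauss_mult_gauss:
  fixes x y z :: "real^'n"
  assumes "s > 0" "t > 0"
  shows "gauss s (x - z) * gauss t (y - z) =
    gauss (s + t) (y - x) * gauss (s * t / (s + t)) ((t / (s + t)) *\<^sub>R x + (s / (s + t)) *\<^sub>R y - z)"
proof -
  define A B where "A = x - z" and "B = y - z"
  have st: "s + t > 0" "s + t \<noteq> 0" using assms by auto
  have w: "(t / (s + t)) *\<^sub>R x + (s / (s + t)) *\<^sub>R y - z = (1 / (s + t)) *\<^sub>R (t *\<^sub>R A + s *\<^sub>R B)"
  proof -
    have "z = (t / (s + t)) *\<^sub>R z + (s / (s + t)) *\<^sub>R z"
      using st by (simp flip: scaleR_add_left add_divide_distrib add: add.commute)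
    then have "(t / (s + t)) *\<^sub>R x + (s / (s + t)) *\<^sub>R y - z =
        (t / (s + t)) *\<^sub>R x + (s / (s + t)) *\<^sub>R y - ((t / (s + t)) *\<^sub>R z + (s / (s + t)) *\<^sub>R z)"
      by metis
    then show ?thesis by (simp add: A_def B_def algebra_simps)
  qed
  have d: "y - x = B - A" by (simp add: A_def B_def)
  have e: "(norm A)\<^sup>2 / (2 * s) + (norm B)\<^sup>2 / (2 * t) =
     (norm (B - A))\<^sup>2 / (2 * (s + t)) + (norm ((1 / (s + t)) *\<^sub>R (t *\<^sub>R A + s *\<^sub>R B)))\<^sup>2 / (2 * (s * t / (s + t)))"
  proof -
    have 1: "(norm (B - A))\<^sup>2 = B \<bullet> B - 2 * (A \<bullet> B) + A \<bullet> A"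
      by (simp add: power2_norm_eq_inner inner_diff inner_commute)
    have 2: "(norm ((1 / (s + t)) *\<^sub>R (t *\<^sub>R A + s *\<^sub>R B)))\<^sup>2 =
      (t\<^sup>2 * (A \<bullet> A) + 2 * s * t * (A \<bullet> B) + s\<^sup>2 * (B \<bullet> B)) / (s + t)\<^sup>2"
    proof -
      have "(norm (t *\<^sub>R A + s *\<^sub>R B))\<^sup>2 = t\<^sup>2 * (A \<bullet> A) + 2 * s * t * (A \<bullet> B) + s\<^sup>2 * (B \<bullet> B)"
        unfolding power2_norm_eq_inner
        by (simp add: inner_add inner_commute power2_eq_square algebra_simps)
      then show ?thesis
        by (simp add: power_mult_distrib power_divide)
    qed
    have 3: "(norm A)\<^sup>2 = A \<bullet> A" "(norm B)\<^sup>2 = B \<bullet> B"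
      by (simp_all add: power2_norm_eq_inner)
    show ?thesis
      unfolding 1 2 3 using assms st by (simp add: divide_simps) algebra
  qed
  have c: "sqrt ((2 * pi * s) ^ CARD('n)) * sqrt ((2 * pi * t) ^ CARD('n)) =
    sqrt ((2 * pi * (s + t)) ^ CARD('n)) * sqrt ((2 * pi * (s * t / (s + t))) ^ CARD('n))"
  proof -
    have "(2 * pi * s) * (2 * pi * t) = (2 * pi * (s + t)) * (2 * pi * (s * t / (s + t)))"
      using st by (simp add: field_simps)
    then show ?thesis by (metis power_mult_distrib real_sqrt_mult)
  qed
  have "gauss s A * gauss t B = exp (- ((norm A)\<^sup>2 / (2 * s) + (norm B)\<^sup>2 / (2 * t))) /
      (sqrt ((2 * pi * s) ^ CARD('n)) * sqrt ((2 * pi * t) ^ CARD('n)))"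
    unfolding gauss_def minus_add_distrib exp_add minus_divide_left by simp
  also have "\<dots> = gauss (s + t) (B - A) * gauss (s * t / (s + t)) ((1 / (s + t)) *\<^sub>R (t *\<^sub>R A + s *\<^sub>R B))"
    unfolding e c gauss_def minus_add_distrib exp_add minus_divide_left by simp
  finally show ?thesis
    unfolding w d by (simp only: A_def B_def)
qed

lemma gauss_scale:
  assumes "s > 0"
  shows "sqrt s ^ CARD('n) * gauss s (sqrt s *\<^sub>R (z::real^'n)) = gauss 1 z"
  using assms
  by (simp add: gauss_def power_mult_distrib real_sqrt_mult real_sqrt_power)

section \<open>Gaussian mass of a set\<close>

text \<open>
  The probability that \<open>N(x, s I)\<close> gives to \<open>K\<close>; as a function of \<open>x\<close> it is the heat semigroup at time
  \<open>s\<close> applied to the indicator of \<open>K\<close>.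
\<close>

definition normal_mass :: "real \<Rightarrow> (real^'n) set \<Rightarrow> real^'n \<Rightarrow> real" where
  "normal_mass s K x = measure (mvn x (mat s)) K"

lemma normal_mass_eq:
  assumes "s > 0" and [measurable]: "K \<in> sets borel"
  shows "ennreal (normal_mass s K x) = (\<integral>\<^sup>+z. ennreal (gauss s (z - x)) * indicator K z \<partial>lborel)"
proof -
  interpret prob_space "mvn x (mat s)" by (rule prob_space_mvn_mat[OF \<open>s > 0\<close>])
  show ?thesis
    using \<open>s > 0\<close> unfolding normal_mass_def emeasure_eq_measure[symmetric]
    by (simp add: mvn_def mvn_density_eq_gauss emeasure_density)
qed

lemma normal_mass_nonneg: "0 \<le> normal_mass s K x"
  by (simp add: normal_mass_def)

lemma normal_mass_le_1:
  fixes x :: "real^'n"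
  assumes "s > 0" shows "normal_mass s K x \<le> 1"
proof -
  interpret prob_space "mvn x (mat s)" by (rule prob_space_mvn_mat[OF \<open>s > 0\<close>])
  show ?thesis unfolding normal_mass_def by simp
qed

lemma normal_mass_measurable [measurable]:
  assumes "s > 0" and [measurable]: "K \<in> sets borel"
  shows "normal_mass s K \<in> borel_measurable borel"
proof -
  have "normal_mass s K = (\<lambda>x. enn2real (\<integral>\<^sup>+z. ennreal (gauss s (z - x)) * indicator K z \<partial>lborel))"
    using normal_mass_eq[OF assms] by (metis enn2real_ennreal normal_mass_nonneg)
  also have "\<dots> \<in> borel_measurable borel" by measurable
  finally show ?thesis .
qed

lemma normal_mass_UNIV:
  fixes x :: "real^'n"
  assumes "s > 0" shows "normal_mass s UNIV x = 1"
proof -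
  have "ennreal (normal_mass s UNIV x) = 1"
    using nn_integral_gauss[OF assms] by (simp add: normal_mass_eq assms)
  then show ?thesis by simp
qed

lemma normal_mass_shift:
  assumes "s > 0" and [measurable]: "K \<in> sets borel" and "\<And>z. z + c \<in> K \<longleftrightarrow> z \<in> K"
  shows "normal_mass s K (x + c) = normal_mass s K x"
proof -
  have "ennreal (normal_mass s K (x + c)) = (\<integral>\<^sup>+z. ennreal (gauss s (z + c - (x + c))) * indicator K (z + c) \<partial>lborel)"
    unfolding normal_mass_eq[OF assms(1,2)]
    by (rule nn_integral_lborel_shift[symmetric, where f = "\<lambda>z. ennreal (gauss s (z - (x + c))) * indicator K z"]) measurable
  also have "\<dots> = ennreal (normal_mass s K x)"
    unfolding normal_mass_eq[OF assms(1,2)] using assms(3) by (simp add: indicator_def)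
  finally show ?thesis by (simp add: normal_mass_nonneg)
qed

lemma normal_mass_mono:
  fixes x :: "real^'n"
  assumes "s > 0" "K \<subseteq> K'" "K' \<in> sets borel"
  shows "normal_mass s K x \<le> normal_mass s K' x"
proof -
  interpret prob_space "mvn x (mat s)" by (rule prob_space_mvn_mat[OF \<open>s > 0\<close>])
  show ?thesis unfolding normal_mass_def using assms by (intro finite_measure_mono) (auto simp: mvn_def)
qed

lemma normal_mass_open_pos:
  fixes x :: "real^'n"
  assumes "s > 0" "open U" "U \<noteq> {}"
  shows "0 < normal_mass s U x"
proof (rule ccontr)
  have [measurable]: "U \<in> sets borel" using \<open>open U\<close> by simp
  assume "\<not> 0 < normal_mass s U x"
  then have "normal_mass s U x = 0" using normal_mass_nonneg[of s U x] by simp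
  then have "(\<integral>\<^sup>+z. ennreal (gauss s (z - x)) * indicator U z \<partial>lborel) = 0"
    using normal_mass_eq[of s U x] assms by simp
  then have "AE z in lborel. z \<notin> U"
    using gauss_pos[OF \<open>s > 0\<close>]
    by (subst (asm) nn_integral_0_iff_AE)
       (auto simp: ennreal_eq_0_iff not_le elim!: eventually_mono split: split_indicator_asm)
  then have "emeasure lborel U = 0"
    using assms by (subst (asm) AE_iff_measurable[OF _ refl]) auto
  then have "negligible U"
    using \<open>open U\<close> by (auto simp: negligible_iff_null_sets null_sets_completion_iff null_sets_def)
  then show False using open_not_negligible assms by blast
qed

lemma normal_mass_strict_mono:
  fixes x :: "real^'n"
  assumes "s > 0" "K \<subseteq> K'" and [measurable]: "K \<in> sets borel" "K' \<in> sets borel"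
    and "open U" "U \<noteq> {}" "U \<subseteq> K' - K"
  shows "normal_mass s K x < normal_mass s K' x"
proof -
  interpret prob_space "mvn x (mat s)" by (rule prob_space_mvn_mat[OF \<open>s > 0\<close>])
  have "normal_mass s K x + normal_mass s U x = measure (mvn x (mat s)) (K \<union> U)"
    unfolding normal_mass_def using assms by (intro finite_measure_Union[symmetric]) (auto simp: mvn_def)
  also have "\<dots> \<le> normal_mass s K' x"
    unfolding normal_mass_def using assms by (intro finite_measure_mono) (auto simp: mvn_def)
  finally show ?thesis using normal_mass_open_pos[OF assms(1,5,6), of x] by simp
qed

lemma homothetic_borel:
  fixes K :: "(real^'n) set"
  assumes "K \<in> sets borel"
  shows "{w. \<theta> + sqrt s *\<^sub>R w \<in> K} \<in> sets borel"
  using measurable_sets_borel[of "\<lambda>w. \<theta> + sqrt s *\<^sub>R w" borel K] assms by (simp add: vimage_def)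

text \<open>
  Standardising turns a change of variance into a dilation of the set about \<open>\<theta>\<close>. This is what makes
  masses at different variances comparable pointwise.
\<close>

lemma normal_mass_scale:
  fixes z \<theta> :: "real^'n"
  assumes "s > 0" and K[measurable]: "K \<in> sets borel"
  shows "normal_mass s K (\<theta> + sqrt s *\<^sub>R z) = normal_mass 1 {w. \<theta> + sqrt s *\<^sub>R w \<in> K} z"
proof -
  let ?K = "{w. \<theta> + sqrt s *\<^sub>R w \<in> K}"
  have K'[measurable]: "?K \<in> sets borel"
    using K by (rule homothetic_borel)
  have sq: "sqrt s \<noteq> 0" using \<open>s > 0\<close> by simp
  have "ennreal (normal_mass s K (\<theta> + sqrt s *\<^sub>R z)) =
     ennreal (\<bar>sqrt s\<bar> ^ DIM(real^'n)) * (\<integral>\<^sup>+w. ennreal (gauss s (\<theta> + sqrt s *\<^sub>R w - (\<theta> + sqrt s *\<^sub>R z))) * indicator K (\<theta> + sqrt s *\<^sub>R w) \<partial>lborel)"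
    unfolding normal_mass_eq[OF assms] 
    by (rule nn_integral_lborel_affine[OF _ sq, where f = "\<lambda>w. ennreal (gauss s (w - (\<theta> + sqrt s *\<^sub>R z))) * indicator K w"]) measurable
  also have "\<dots> = (\<integral>\<^sup>+w. ennreal (sqrt s ^ CARD('n) * gauss s (sqrt s *\<^sub>R (w - z))) * indicator ?K w \<partial>lborel)"
    using \<open>s > 0\<close> by (subst nn_integral_cmult[symmetric]) (auto intro!: nn_integral_cong simp: indicator_def ennreal_mult gauss_nonneg algebra_simps)
  also have "\<dots> = ennreal (normal_mass 1 ?K z)"
    unfolding gauss_scale[OF \<open>s > 0\<close>] by (simp add: normal_mass_eq)
  finally show ?thesis by (simp add: normal_mass_nonneg)
qed

text \<open>
  The mass of a set with interior points decays at most like a Gaussian, because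
  \<open>norm (z - x)\<^sup>2 \<le> 2 * norm (z - \<theta>)\<^sup>2 + 2 * norm (x - \<theta>)\<^sup>2\<close> bounds the kernel at \<open>x\<close> below by a
  multiple of the kernel at \<open>\<theta>\<close> of half the variance. Hence the logarithm of the mass grows at most
  quadratically.
\<close>

lemma normal_mass_lower_bound:
  fixes \<theta> :: "real^'n"
  assumes "s > 0" and K[measurable]: "K \<in> sets borel" and "interior K \<noteq> {}"
  shows "\<exists>\<kappa>>0. \<forall>x. \<kappa> * exp (- (norm (x - \<theta>))\<^sup>2 / s) \<le> normal_mass s K x"
proof -
  have half: "0 < s / 2" using \<open>s > 0\<close> by simp
  define \<kappa> where "\<kappa> = normal_mass (s/2) K \<theta> * (sqrt ((2 * pi * (s/2)) ^ CARD('n)) / sqrt ((2 * pi * s) ^ CARD('n)))"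
  have "0 < normal_mass (s/2) (interior K) \<theta>"
    by (rule normal_mass_open_pos) (use assms in auto)
  also have "\<dots> \<le> normal_mass (s/2) K \<theta>"
    by (rule normal_mass_mono) (use assms interior_subset in auto)
  finally have pos: "\<kappa> > 0" unfolding \<kappa>_def using \<open>s > 0\<close> by (intro mult_pos_pos divide_pos_pos) auto
  have pw: "exp (- (norm (x - \<theta>))\<^sup>2 / s) * (sqrt ((2 * pi * (s/2)) ^ CARD('n)) / sqrt ((2 * pi * s) ^ CARD('n))) * gauss (s/2) (z - \<theta>) \<le> gauss s (z - x)" for x z :: "real^'n"
  proof -
    have tri: "norm (z - x) \<le> norm (z - \<theta>) + norm (x - \<theta>)"
      by (metis dist_norm dist_triangle2)
    have "(norm (z - x))\<^sup>2 \<le> (norm (z - \<theta>) + norm (x - \<theta>))\<^sup>2"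
      using tri by (intro power_mono) auto
    also have "\<dots> \<le> 2 * (norm (z - \<theta>))\<^sup>2 + 2 * (norm (x - \<theta>))\<^sup>2"
      using sum_squares_bound[of "norm (z - \<theta>)" "norm (x - \<theta>)"] by (simp add: power2_sum)
    finally have "(norm (z - x))\<^sup>2 / (2 * s) \<le> (2 * (norm (z - \<theta>))\<^sup>2 + 2 * (norm (x - \<theta>))\<^sup>2) / (2 * s)"
      using \<open>s > 0\<close> by (intro divide_right_mono) auto
    then have "- (norm (x - \<theta>))\<^sup>2 / s + - (norm (z - \<theta>))\<^sup>2 / (2 * (s/2)) \<le> - (norm (z - x))\<^sup>2 / (2 * s)"
      using \<open>s > 0\<close> by (simp add: add_divide_distrib)
    then have "exp (- (norm (x - \<theta>))\<^sup>2 / s) * exp (- (norm (z - \<theta>))\<^sup>2 / (2 * (s/2))) \<le> exp (- (norm (z - x))\<^sup>2 / (2 * s))"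
      by (simp flip: exp_add)
    then have "exp (- (norm (x - \<theta>))\<^sup>2 / s) * exp (- (norm (z - \<theta>))\<^sup>2 / (2 * (s/2))) / sqrt ((2 * pi * s) ^ CARD('n)) \<le> gauss s (z - x)"
      unfolding gauss_def using \<open>s > 0\<close> by (intro divide_right_mono) auto
    moreover have "sqrt ((2 * pi * (s/2)) ^ CARD('n)) \<noteq> 0" using \<open>s > 0\<close> by simp
    ultimately show ?thesis unfolding gauss_def[of "s/2"] by simp
  qed
  have "\<kappa> * exp (- (norm (x - \<theta>))\<^sup>2 / s) \<le> normal_mass s K x" for x
  proof -
    let ?c = "exp (- (norm (x - \<theta>))\<^sup>2 / s) * (sqrt ((2 * pi * (s/2)) ^ CARD('n)) / sqrt ((2 * pi * s) ^ CARD('n)))"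
    have c: "?c \<ge> 0" using \<open>s > 0\<close> by simp
    have "ennreal (?c * normal_mass (s/2) K \<theta>) = (\<integral>\<^sup>+z. ennreal ?c * (ennreal (gauss (s/2) (z - \<theta>)) * indicator K z) \<partial>lborel)"
      by (subst nn_integral_cmult) (use c half in \<open>simp_all add: ennreal_mult normal_mass_nonneg normal_mass_eq[symmetric] del: times_divide_eq_right\<close>)
    also have "\<dots> \<le> (\<integral>\<^sup>+z. ennreal (gauss s (z - x)) * indicator K z \<partial>lborel)"
      using c half pw[of x] by (intro nn_integral_mono) (auto simp: indicator_def ennreal_leI gauss_nonneg simp flip: ennreal_mult)
    also have "\<dots> = ennreal (normal_mass s K x)" using \<open>s > 0\<close> by (simp add: normal_mass_eq)
    finally have "?c * normal_mass (s/2) K \<theta> \<le> normal_mass s K x" by (simp add: normal_mass_nonneg)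
    then show ?thesis by (simp add: \<kappa>_def mult_ac)
  qed
  with pos show ?thesis by blast
qed

lemma normal_mass_pos:
  fixes x :: "real^'n"
  assumes "s > 0" "K \<in> sets borel" "interior K \<noteq> {}"
  shows "0 < normal_mass s K x"
  using normal_mass_open_pos[of s "interior K" x] normal_mass_mono[of s "interior K" K x] assms interior_subset
  by (auto intro: less_le_trans)

section \<open>Expected logarithm of the Gaussian mass of a convex set\<close>

text \<open>
  The expectation of \<open>- ln (normal_mass s K X)\<close> under \<open>X \<sim> N(\<theta>, s I)\<close>: the variance of the observation and
  that of the mass are the same parameter.
\<close>

definition log_loss :: "real \<Rightarrow> (real^'n) set \<Rightarrow> real^'n \<Rightarrow> ennreal" where
  "log_loss s K \<theta> = (\<integral>\<^sup>+x. ennreal (- ln (normal_mass s K x)) * ennreal (gauss s (x - \<theta>)) \<partial>lborel)"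

lemma log_loss_scale:
  fixes \<theta> :: "real^'n"
  assumes "s > 0" and K[measurable]: "K \<in> sets borel"
  shows "log_loss s K \<theta> = log_loss 1 {w. \<theta> + sqrt s *\<^sub>R w \<in> K} 0"
proof -
  have [measurable]: "normal_mass s K \<in> borel_measurable borel"
    using assms by (rule normal_mass_measurable)
  have sq: "sqrt s \<noteq> 0" using \<open>s > 0\<close> by simp
  have [measurable]: "{w. \<theta> + sqrt s *\<^sub>R w \<in> K} \<in> sets borel"
    using K by (rule homothetic_borel)
  have "log_loss s K \<theta> = ennreal (\<bar>sqrt s\<bar> ^ DIM(real^'n)) *
      (\<integral>\<^sup>+w. ennreal (- ln (normal_mass s K (\<theta> + sqrt s *\<^sub>R w))) * ennreal (gauss s (\<theta> + sqrt s *\<^sub>R w - \<theta>)) \<partial>lborel)"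
    unfolding log_loss_def
    by (rule nn_integral_lborel_affine[OF _ sq, where f = "\<lambda>x. ennreal (- ln (normal_mass s K x)) * ennreal (gauss s (x - \<theta>))"]) measurable
  also have "\<dots> = (\<integral>\<^sup>+w. ennreal (- ln (normal_mass s K (\<theta> + sqrt s *\<^sub>R w))) * ennreal (sqrt s ^ CARD('n) * gauss s (sqrt s *\<^sub>R w)) \<partial>lborel)"
    using \<open>s > 0\<close> by (subst nn_integral_cmult[symmetric]) (auto intro!: nn_integral_cong simp: ennreal_mult gauss_nonneg mult_ac)
  also have "\<dots> = log_loss 1 {w. \<theta> + sqrt s *\<^sub>R w \<in> K} 0"
    unfolding gauss_scale[OF \<open>s > 0\<close>] log_loss_def normal_mass_scale[OF assms] by simp
  finally show ?thesis .
qed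

text \<open>
  The quadratic growth of the integrand is absorbed by \<open>u \<le> 4 * exp (u / 4)\<close>: with
  \<open>u = norm (x - \<theta>)\<^sup>2 / s\<close>, the exponential turns the Gaussian kernel of variance \<open>s\<close> into a multiple of
  the one of variance \<open>2 * s\<close>.
\<close>

lemma log_loss_finite:
  fixes \<theta> :: "real^'n"
  assumes "s > 0" and K: "K \<in> sets borel" "interior K \<noteq> {}"
  shows "log_loss s K \<theta> < \<infinity>"
proof -
  obtain \<kappa> where \<kappa>: "\<kappa> > 0" "\<And>x. \<kappa> * exp (- (norm (x - \<theta>))\<^sup>2 / s) \<le> normal_mass s K x"
    using normal_mass_lower_bound[OF assms, of \<theta>] by blast
  define c where "c = 4 * (sqrt ((2 * pi * (2 * s)) ^ CARD('n)) / sqrt ((2 * pi * s) ^ CARD('n)))"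
  have c: "c \<ge> 0" using \<open>s > 0\<close> by (simp add: c_def)
  have "- ln (normal_mass s K x) * gauss s (x - \<theta>) \<le> \<bar>ln \<kappa>\<bar> * gauss s (x - \<theta>) + c * gauss (2 * s) (x - \<theta>)" for x
  proof -
    define r where "r = (norm (x - \<theta>))\<^sup>2 / s"
    have "ln (\<kappa> * exp (- r)) \<le> ln (normal_mass s K x)"
      using \<kappa> by (intro ln_mono) (auto simp: r_def)
    then have "- ln (normal_mass s K x) \<le> - ln \<kappa> + r"
      using \<kappa>(1) by (simp add: ln_mult)
    also have "\<dots> \<le> \<bar>ln \<kappa>\<bar> + 4 * exp (r / 4)"
      using exp_ge_add_one_self[of "r / 4"] by linarith
    finally have "- ln (normal_mass s K x) * gauss s (x - \<theta>) \<le> (\<bar>ln \<kappa>\<bar> + 4 * exp (r / 4)) * gauss s (x - \<theta>)"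
      using \<open>s > 0\<close> by (intro mult_right_mono gauss_nonneg)
    moreover have "4 * exp (r / 4) * gauss s (x - \<theta>) = c * gauss (2 * s) (x - \<theta>)"
    proof -
      have "exp (r / 4) * exp (- (norm (x - \<theta>))\<^sup>2 / (2 * s)) = exp (- (norm (x - \<theta>))\<^sup>2 / (2 * (2 * s)))"
        using \<open>s > 0\<close> by (simp add: r_def flip: exp_add)
      moreover have "sqrt ((2 * pi * (2 * s)) ^ CARD('n)) \<noteq> 0" using \<open>s > 0\<close> by simp
      ultimately show ?thesis unfolding gauss_def c_def by simp
    qed
    ultimately show ?thesis by (simp add: algebra_simps)
  qed
  then have "log_loss s K \<theta> \<le> (\<integral>\<^sup>+x. ennreal \<bar>ln \<kappa>\<bar> * ennreal (gauss s (x - \<theta>)) + ennreal c * ennreal (gauss (2 * s) (x - \<theta>)) \<partial>lborel)"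
    unfolding log_loss_def using \<open>s > 0\<close> c
    by (intro nn_integral_mono) (auto simp: gauss_nonneg ennreal_leI simp flip: ennreal_mult' ennreal_mult'' ennreal_plus)
  also have "\<dots> = ennreal \<bar>ln \<kappa>\<bar> + ennreal c"
    using \<open>s > 0\<close> by (simp add: nn_integral_add nn_integral_cmult nn_integral_gauss)
  also have "\<dots> < \<infinity>" by simp
  finally show ?thesis .
qed

text \<open>
  A convex set is star-shaped about each of its points \<open>\<theta>\<close>, so shrinking towards \<open>\<theta>\<close> keeps its points
  inside.
\<close>

lemma homothetic_subset:
  fixes K :: "(real^'n) set"
  assumes "0 < s" "s \<le> t" "convex K" "\<theta> \<in> K"
  shows "{w. \<theta> + sqrt t *\<^sub>R w \<in> K} \<subseteq> {w. \<theta> + sqrt s *\<^sub>R w \<in> K}"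
proof safe
  fix w assume w: "\<theta> + sqrt t *\<^sub>R w \<in> K"
  define r where "r = sqrt s / sqrt t"
  have r: "0 \<le> r" "r \<le> 1" and rt: "sqrt s = r * sqrt t" using assms by (auto simp: r_def)
  have "(1 - r) *\<^sub>R \<theta> + r *\<^sub>R (\<theta> + sqrt t *\<^sub>R w) \<in> K"
    using assms w r by (intro convexD) auto
  then show "\<theta> + sqrt s *\<^sub>R w \<in> K" by (simp add: rt algebra_simps)
qed

text \<open>
  For \<open>\<theta>\<close> in the interior, a ray from \<open>\<theta>\<close> through a boundary point \<open>b\<close> runs in the interior of \<open>K\<close>
  before \<open>b\<close> and outside \<open>K\<close> after \<open>b\<close>. A multiple of \<open>b - \<theta>\<close> chosen between the two scales lies in the
  gap, and the gap contains a neighbourhood of it.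
\<close>

lemma homothetic_gap:
  fixes K :: "(real^'n) set"
  assumes "0 < s" "s < t" "convex K" "closed K" "K \<noteq> UNIV" "\<theta> \<in> interior K"
  shows "\<exists>U. open U \<and> U \<noteq> {} \<and> U \<subseteq> {w. \<theta> + sqrt s *\<^sub>R w \<in> K} - {w. \<theta> + sqrt t *\<^sub>R w \<in> K}"
proof -
  have K: "\<theta> \<in> K" using assms(6) interior_subset by auto
  have st: "0 < sqrt s" "sqrt s < sqrt t" using assms by auto
  obtain b where b: "b \<in> frontier K"
    using assms K frontier_eq_empty[of K] by auto
  then have bK: "b \<in> K" "b \<notin> interior K"
    using \<open>closed K\<close> by (auto simp: frontier_def)
  define v where "v = b - \<theta>"
  have inner: "\<theta> + r *\<^sub>R v \<in> interior K" if "0 \<le> r" "r < 1" for r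
  proof -
    have "b - (1 - r) *\<^sub>R (b - \<theta>) \<in> interior K"
      using assms bK(1) that by (intro mem_interior_convex_shrink) auto
    then show ?thesis by (simp add: v_def algebra_simps)
  qed
  have outer: "\<theta> + r *\<^sub>R v \<notin> K" if "r > 1" for r
  proof
    assume "\<theta> + r *\<^sub>R v \<in> K"
    then have "(\<theta> + r *\<^sub>R v) - (1 - 1 / r) *\<^sub>R ((\<theta> + r *\<^sub>R v) - \<theta>) \<in> interior K"
      using assms that by (intro mem_interior_convex_shrink) auto
    moreover have "(\<theta> + r *\<^sub>R v) - (1 - 1 / r) *\<^sub>R ((\<theta> + r *\<^sub>R v) - \<theta>) = b"
      using that by (simp add: v_def algebra_simps)
    ultimately show False using bK by simp
  qed
  obtain m where m: "1 / sqrt t < m" "m < 1 / sqrt s"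
    using dense[of "1 / sqrt t" "1 / sqrt s"] st by (auto simp: divide_strict_left_mono)
  let ?U = "(\<lambda>w. \<theta> + sqrt s *\<^sub>R w) -` interior K \<inter> (\<lambda>w. \<theta> + sqrt t *\<^sub>R w) -` (- K)"
  have "open ?U"
    by (intro open_Int open_vimage open_interior open_Compl \<open>closed K\<close> continuous_intros)
  moreover have "m *\<^sub>R v \<in> ?U"
  proof -
    have "0 < 1 / sqrt t" using st by simp
    then have "0 < m" using m by linarith
    then have "0 \<le> sqrt s * m" "sqrt s * m < 1" "1 < sqrt t * m"
      using m st by (simp_all add: field_simps)
    then show ?thesis using inner outer by simp
  qed
  moreover have "?U \<subseteq> {w. \<theta> + sqrt s *\<^sub>R w \<in> K} - {w. \<theta> + sqrt t *\<^sub>R w \<in> K}"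
    using interior_subset by auto
  ultimately show ?thesis by blast
qed

lemma homothetic_interior:
  fixes K :: "(real^'n) set"
  assumes "s > 0" "interior K \<noteq> {}"
  shows "interior {w. \<theta> + sqrt s *\<^sub>R w \<in> K} \<noteq> {}"
proof -
  have "open ((\<lambda>w. \<theta> + sqrt s *\<^sub>R w) -` interior K)"
    by (intro open_vimage open_interior continuous_intros)
  moreover have "(\<lambda>w. \<theta> + sqrt s *\<^sub>R w) -` interior K \<subseteq> {w. \<theta> + sqrt s *\<^sub>R w \<in> K}"
    using interior_subset by auto
  moreover obtain k where "k \<in> interior K" using assms by auto
  then have "(1 / sqrt s) *\<^sub>R (k - \<theta>) \<in> (\<lambda>w. \<theta> + sqrt s *\<^sub>R w) -` interior K"
    using assms by simp
  ultimately show ?thesis using interior_maximal by blast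
qed

text \<open>
  After standardisation both sides are expectations under the same standard normal law, and the integrands
  compare pointwise because the rescaled sets are nested.
\<close>

lemma log_loss_mono:
  fixes \<theta> :: "real^'n"
  assumes "0 < s" "s \<le> t" "convex K" "closed K" "interior K \<noteq> {}" "\<theta> \<in> K"
  shows "log_loss s K \<theta> \<le> log_loss t K \<theta>"
proof -
  have K: "K \<in> sets borel" and t: "t > 0" using assms by auto
  have "log_loss 1 {w. \<theta> + sqrt s *\<^sub>R w \<in> K} 0 \<le> log_loss 1 {w. \<theta> + sqrt t *\<^sub>R w \<in> K} 0"
    unfolding log_loss_def
    using assms t
    by (intro nn_integral_mono mult_right_mono ennreal_leI le_imp_neg_le ln_mono
       normal_mass_mono homothetic_subset normal_mass_pos homothetic_interior homothetic_borel K) auto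
  then show ?thesis
    using log_loss_scale[of s K \<theta>] log_loss_scale[of t K \<theta>] assms t K by simp
qed

text \<open>
  A normal law charges the gap between the rescaled sets wherever it is centred, so the integrands differ
  at every point, and the smaller one has a finite integral.
\<close>

lemma log_loss_strict_mono:
  fixes \<theta> :: "real^'n"
  assumes "0 < s" "s < t" "convex K" "closed K" "K \<noteq> UNIV" "\<theta> \<in> interior K"
  shows "log_loss s K \<theta> < log_loss t K \<theta>"
proof -
  let ?S = "{w. \<theta> + sqrt s *\<^sub>R w \<in> K}" and ?T = "{w. \<theta> + sqrt t *\<^sub>R w \<in> K}"
  have K: "K \<in> sets borel" "interior K \<noteq> {}" "\<theta> \<in> K" and t: "t > 0"
    using assms interior_subset by auto
  have S: "?S \<in> sets borel" and T: "?T \<in> sets borel"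
    using homothetic_borel K by auto
  note [measurable] = normal_mass_measurable[OF zero_less_one S] normal_mass_measurable[OF zero_less_one T]
  obtain U where U: "open U" "U \<noteq> {}" "U \<subseteq> ?S - ?T"
    using homothetic_gap[OF assms] by blast
  let ?f = "\<lambda>z. ennreal (- ln (normal_mass 1 ?S z)) * ennreal (gauss 1 (z - 0))"
  let ?g = "\<lambda>z. ennreal (- ln (normal_mass 1 ?T z)) * ennreal (gauss 1 (z - 0))"
  have less: "?f z < ?g z" for z
  proof -
    have "normal_mass 1 ?T z < normal_mass 1 ?S z"
      by (rule normal_mass_strict_mono[OF _ _ T S U]) (use homothetic_subset[of s t K \<theta>] assms K in auto)
    moreover have "0 < normal_mass 1 ?T z"
      by (rule normal_mass_pos) (use T t K homothetic_interior in auto)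
    moreover have "normal_mass 1 ?S z \<le> 1" by (rule normal_mass_le_1) simp
    ultimately have "ln (normal_mass 1 ?T z) < ln (normal_mass 1 ?S z)" "ln (normal_mass 1 ?S z) \<le> 0"
      by (auto simp: ln_le_zero_iff)
    then show ?thesis
      using gauss_pos[of 1 z] by (subst (1 2) ennreal_mult[symmetric]) (auto simp: ennreal_less_iff mult_le_0_iff)
  qed
  have "log_loss 1 ?S 0 < log_loss 1 ?T 0"
    unfolding log_loss_def
  proof (rule nn_integral_less)
    show "(\<integral>\<^sup>+z. ?f z \<partial>lborel) \<noteq> \<infinity>"
      using log_loss_finite[of 1 ?S 0] S homothetic_interior[of s K \<theta>] K assms by (auto simp: log_loss_def)
    show "AE z in lborel. ?f z \<le> ?g z" using less by (auto intro: less_imp_le)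
    show "\<not> (AE z in lborel. ?g z \<le> ?f z)"
    proof
      assume "AE z in lborel. ?g z \<le> ?f z"
      then have "AE z in lborel. z \<notin> (UNIV :: (real^'n) set)"
        by (rule eventually_mono) (use less in \<open>simp add: not_le[symmetric]\<close>)
      then have "(UNIV :: (real^'n) set) \<in> null_sets lborel"
        by (subst AE_iff_null_sets) auto
      then show False by auto
    qed
  qed measurable
  then show ?thesis
    using log_loss_scale[of s K \<theta>] log_loss_scale[of t K \<theta>] assms t K by simp
qed

section \<open>Extended integrals\<close>

text \<open>
  A real integrable function may be subtracted under the extended integral as soon as the negative part of
  \<open>f\<close> has a finite integral; \<open>f\<close> itself may take infinite values and have an infinite integral. All terms
  of \<open>(f - g)\<^sup>+ + f\<^sup>- + g\<^sup>+ = (f - g)\<^sup>- + f\<^sup>+ + g\<^sup>-\<close> are nonnegative, so the identity integrates without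
  cancellation.
\<close>

lemma ext_integral_diff:
  fixes f :: "'a \<Rightarrow> ereal" and g :: "'a \<Rightarrow> real"
  assumes [measurable]: "f \<in> borel_measurable M" and g: "integrable M g"
    and fin: "(\<integral>\<^sup>+x. e2ennreal (- f x) \<partial>M) < \<infinity>"
  shows "ext_integral M (\<lambda>x. f x - ereal (g x)) = ext_integral M f - ereal (integral\<^sup>L M g)"
proof -
  have [measurable]: "g \<in> borel_measurable M" using g by auto
  let ?P = "\<integral>\<^sup>+x. e2ennreal (f x) \<partial>M" and ?N = "\<integral>\<^sup>+x. e2ennreal (- f x) \<partial>M"
    and ?P' = "\<integral>\<^sup>+x. e2ennreal (f x - ereal (g x)) \<partial>M" and ?N' = "\<integral>\<^sup>+x. e2ennreal (- (f x - ereal (g x))) \<partial>M"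
    and ?a = "\<integral>\<^sup>+x. ennreal (g x) \<partial>M" and ?b = "\<integral>\<^sup>+x. ennreal (- g x) \<partial>M"
  have real: "ennreal (r - u) + ennreal (- r) + ennreal u = ennreal (- (r - u)) + ennreal r + ennreal (- u)" for r u
  proof -
    have "ennreal (max 0 (r - u) + max 0 (- r) + max 0 u) = ennreal (max 0 (- (r - u)) + max 0 r + max 0 (- u))"
      by (rule arg_cong[where f = ennreal]) (auto simp: max_def)
    then show ?thesis by (simp add: ennreal_plus)
  qed
  have "e2ennreal (f x - ereal (g x)) + e2ennreal (- f x) + ennreal (g x) =
      e2ennreal (- (f x - ereal (g x))) + e2ennreal (f x) + ennreal (- g x)" for x
    by (cases "f x") (auto simp: real)
  then have "(\<integral>\<^sup>+x. e2ennreal (f x - ereal (g x)) + e2ennreal (- f x) + ennreal (g x) \<partial>M) =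
      (\<integral>\<^sup>+x. e2ennreal (- (f x - ereal (g x))) + e2ennreal (f x) + ennreal (- g x) \<partial>M)"
    by simp
  then have eq: "?P' + ?N + ?a = ?N' + ?P + ?b"
    by (simp add: nn_integral_add)
  have "e2ennreal (- (f x - ereal (g x))) \<le> e2ennreal (- f x) + ennreal (g x)" for x
  proof (cases "f x")
    case (real r)
    have "ennreal (g x - r) \<le> ennreal (max 0 (- r) + max 0 (g x))" by (intro ennreal_leI) auto
    also have "\<dots> = ennreal (- r) + ennreal (g x)" by (simp add: ennreal_max_0')
    finally show ?thesis using real by simp
  qed auto
  then have "?N' \<le> (\<integral>\<^sup>+x. e2ennreal (- f x) + ennreal (g x) \<partial>M)" by (rule nn_integral_mono)
  also have "\<dots> = ?N + ?a" by (simp add: nn_integral_add)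
  finally have N': "?N' \<le> ?N + ?a" .
  have ab: "?a < \<infinity>" "?b < \<infinity>" using g by (auto simp: real_integrable_def top.not_eq_extremum)
  obtain n where n: "?N = ennreal n" "n \<ge> 0" using fin by (cases ?N) auto
  obtain a where a: "?a = ennreal a" "a \<ge> 0" using ab by (cases ?a) auto
  obtain b where b: "?b = ennreal b" "b \<ge> 0" using ab by (cases ?b) auto
  have "?N' < \<infinity>" using N' n a by (auto simp: top_unique less_top[symmetric] simp flip: ennreal_plus)
  then obtain n' where n': "?N' = ennreal n'" "n' \<ge> 0" by (cases ?N') auto
  have int: "integral\<^sup>L M g = a - b"
    using g a b by (simp add: real_lebesgue_integral_def)
  show ?thesis
  proof (cases ?P)
    case (real u)
    then have "?P' \<noteq> \<infinity>" using eq n a b n' by (auto simp flip: ennreal_plus)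
    then obtain u' where u': "?P' = ennreal u'" "u' \<ge> 0" by (cases ?P') auto
    have "ennreal (u' + n + a) = ennreal (n' + u + b)"
      using eq real n a b n' u' by (simp flip: ennreal_plus)
    then have "u' + n + a = n' + u + b"
      using real n a b n' u' by (subst (asm) ennreal_inj) auto
    then show ?thesis unfolding ext_integral_def int real(2) n(1) n'(1) u'(1)
      using real(1) n(2) n'(2) u'(2) by simp
  next
    case top
    then have "?P' = \<infinity>" using eq n a b n' by auto
    then show ?thesis unfolding ext_integral_def int top n(1) n'(1)
      using n(2) n'(2) by simp
  qed
qed

lemma ext_integral_lebesgue: "ext_integral lebesgue f = ext_integral lborel f"
  by (simp add: ext_integral_def nn_integral_completion)

lemma ext_integral_cong_AE:
  assumes "AE x in M. f x = g x"
  shows "ext_integral M f = ext_integral M g"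
proof -
  have "(\<integral>\<^sup>+x. e2ennreal (f x) \<partial>M) = (\<integral>\<^sup>+x. e2ennreal (g x) \<partial>M)"
    by (rule nn_integral_cong_AE) (use assms in \<open>auto elim: eventually_mono\<close>)
  moreover have "(\<integral>\<^sup>+x. e2ennreal (- f x) \<partial>M) = (\<integral>\<^sup>+x. e2ennreal (- g x) \<partial>M)"
    by (rule nn_integral_cong_AE) (use assms in \<open>auto elim: eventually_mono\<close>)
  ultimately show ?thesis by (simp add: ext_integral_def)
qed

lemma ext_integral_lborel_shift:
  fixes c :: "'a::euclidean_space"
  assumes [measurable]: "f \<in> borel_measurable borel"
  shows "ext_integral lborel (\<lambda>x. f (x + c)) = ext_integral lborel f"
  unfolding ext_integral_def
  using nn_integral_lborel_shift[of "\<lambda>x. e2ennreal (f x)" c] nn_integral_lborel_shift[of "\<lambda>x. e2ennreal (- f x)" c]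
  by simp

lemma ext_integral_ge:
  assumes "(\<integral>\<^sup>+x. e2ennreal (- f x) \<partial>M) \<le> ennreal c" "c \<ge> 0"
  shows "- ereal c \<le> ext_integral M f"
proof -
  have "enn2ereal (\<integral>\<^sup>+x. e2ennreal (- f x) \<partial>M) \<le> ereal c"
    using assms by (metis enn2ereal_ennreal less_eq_ennreal.rep_eq)
  moreover have "0 \<le> enn2ereal (\<integral>\<^sup>+x. e2ennreal (f x) \<partial>M)" by simp
  ultimately show ?thesis
    unfolding ext_integral_def minus_ereal_def
    by (metis add.left_neutral add_mono ereal_minus_le_minus)
qed

section \<open>Mean mixtures of normal densities\<close>

lemma (in prob_space) expectation_pos_bounded:
  fixes f :: "'a \<Rightarrow> real"
  assumes [measurable]: "f \<in> borel_measurable M" and f: "\<And>x. 0 < f x" "\<And>x. f x \<le> B"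
  shows "ennreal (expectation f) = (\<integral>\<^sup>+x. ennreal (f x) \<partial>M)"
    and "0 < expectation f" and "expectation f \<le> B"
proof -
  have int: "integrable M f"
    by (rule integrable_const_bound[where B = B]) (use f in \<open>auto simp: less_imp_le\<close>)
  show "ennreal (expectation f) = (\<integral>\<^sup>+x. ennreal (f x) \<partial>M)"
    by (rule nn_integral_eq_integral[symmetric, OF int]) (use f in \<open>auto simp: less_imp_le\<close>)
  show "0 < expectation f"
    using expectation_greater[OF int, of 0] f by simp
  have "expectation f \<le> expectation (\<lambda>_. B)"
    by (rule integral_mono[OF int]) (use f in auto)
  then show "expectation f \<le> B" by (simp add: prob_space)
qed

lemma
  fixes \<theta> a :: "real^'n"
  assumes "is_cdf L" "s > 0"
  shows ennreal_MMN_density: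
      "ennreal (MMN_density \<theta> a (mat s) L x) = (\<integral>\<^sup>+v. ennreal (gauss s (x - \<theta> - v *\<^sub>R a)) \<partial>interval_measure L)"
    and MMN_density_pos: "0 < MMN_density \<theta> a (mat s) L x"
    and MMN_density_le: "MMN_density \<theta> a (mat s) L x \<le> 1 / sqrt ((2 * pi * s) ^ CARD('n))"
proof -
  interpret real_distribution "interval_measure L"
    using assms by (intro is_cdf_real_distribution)
  have eq: "MMN_density \<theta> a (mat s) L x = expectation (\<lambda>v. gauss s (x - \<theta> - v *\<^sub>R a))"
    unfolding MMN_density_def mvn_density_eq_gauss[OF \<open>s > 0\<close>] by (simp add: algebra_simps)
  note * = expectation_pos_bounded[of "\<lambda>v. gauss s (x - \<theta> - v *\<^sub>R a)", OF _ gauss_pos gauss_le, OF _ \<open>s > 0\<close> \<open>s > 0\<close>]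
  show "ennreal (MMN_density \<theta> a (mat s) L x) = (\<integral>\<^sup>+v. ennreal (gauss s (x - \<theta> - v *\<^sub>R a)) \<partial>interval_measure L)"
    unfolding eq by (rule *(1)) measurable
  show "0 < MMN_density \<theta> a (mat s) L x"
    unfolding eq by (rule *(2)) measurable
  show "MMN_density \<theta> a (mat s) L x \<le> 1 / sqrt ((2 * pi * s) ^ CARD('n))"
    unfolding eq by (rule *(3)) measurable
qed

lemma MMN_density_translate:
  fixes \<theta> a x :: "real^'n"
  assumes "s > 0"
  shows "MMN_density (\<theta> + c) a (mat s) L (x + c) = MMN_density \<theta> a (mat s) L x"
  using assms unfolding MMN_density_def by (simp add: mvn_density_eq_gauss algebra_simps)

lemma MMN_density_measurable:
  fixes a :: "real^'n" and f g :: "'b \<Rightarrow> real^'n"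
  assumes "is_cdf L" "s > 0" and [measurable]: "f \<in> borel_measurable M" "g \<in> borel_measurable M"
  shows "(\<lambda>w. MMN_density (f w) a (mat s) L (g w)) \<in> borel_measurable M"
proof -
  have "(\<lambda>w. MMN_density (f w) a (mat s) L (g w)) = (\<lambda>w. MMN_density 0 a (mat s) L (g w - f w))"
    using MMN_density_translate[OF \<open>s > 0\<close>, of 0 "f w" a L "g w - f w" for w] by simp
  then show ?thesis
    using measurable_compose[OF _ MMN_eq_density(2)[OF assms(1,2), of 0 a], of "\<lambda>w. g w - f w" M] by simp
qed

text \<open>
  The mixing only moves mass along \<open>a\<close>, which a function constant in that direction does not see: for such
  functions the mixture may be replaced by a plain Gaussian.
\<close>

lemma nn_integral_MMN_density:
  fixes \<theta> a :: "real^'n"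
  assumes L: "is_cdf L" and "s > 0" and [measurable]: "f \<in> borel_measurable borel"
    and inv: "\<And>x v. f (x + v *\<^sub>R a) = f x"
  shows "(\<integral>\<^sup>+x. f x * ennreal (MMN_density \<theta> a (mat s) L x) \<partial>lborel) =
    (\<integral>\<^sup>+x. f x * ennreal (gauss s (x - \<theta>)) \<partial>lborel)"
proof -
  interpret real_distribution "interval_measure L"
    using L by (intro is_cdf_real_distribution)
  interpret P: pair_sigma_finite "interval_measure L" lborel ..
  have shift: "(\<integral>\<^sup>+x. f x * ennreal (gauss s (x - \<theta> - v *\<^sub>R a)) \<partial>lborel) =
      (\<integral>\<^sup>+x. f x * ennreal (gauss s (x - \<theta>)) \<partial>lborel)" for v
    using nn_integral_lborel_shift[of "\<lambda>x. f x * ennreal (gauss s (x - \<theta> - v *\<^sub>R a))" "v *\<^sub>R a"]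
    by (simp add: inv algebra_simps)
  have "(\<integral>\<^sup>+x. f x * ennreal (MMN_density \<theta> a (mat s) L x) \<partial>lborel) =
      (\<integral>\<^sup>+x. (\<integral>\<^sup>+v. f x * ennreal (gauss s (x - \<theta> - v *\<^sub>R a)) \<partial>interval_measure L) \<partial>lborel)"
    using L \<open>s > 0\<close> by (simp add: ennreal_MMN_density nn_integral_cmult)
  also have "\<dots> = (\<integral>\<^sup>+v. (\<integral>\<^sup>+x. f x * ennreal (gauss s (x - \<theta> - v *\<^sub>R a)) \<partial>lborel) \<partial>interval_measure L)"
    by (rule P.Fubini') measurable
  also have "\<dots> = (\<integral>\<^sup>+x. f x * ennreal (gauss s (x - \<theta>)) \<partial>lborel)"
    unfolding shift by (simp add: emeasure_space_1[simplified])
  finally show ?thesis .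
qed

section \<open>Predictive densities for priors invariant along the perturbation\<close>

text \<open>
  Observation \<open>X\<close> with variance \<open>s\<close> and mixing law \<open>L1\<close>, future value \<open>Y\<close> with variance \<open>t\<close> and mixing
  law \<open>L2\<close>, and a common perturbation direction \<open>a\<close>.
\<close>

locale MMN_pair =
  fixes a :: "real^'n" and s t :: real and L1 L2 :: "real \<Rightarrow> real"
  assumes s: "s > 0" and t: "t > 0" and L1: "is_cdf L1" and L2: "is_cdf L2"
begin

abbreviation p where "p \<theta> \<equiv> MMN_density \<theta> a (mat s) L1"
abbreviation q where "q \<theta> \<equiv> MMN_density \<theta> a (mat t) L2"

text \<open>
  The density of the MMN law with location \<open>0\<close>, covariance \<open>(s + t) I\<close> and mixing variable
  \<open>V2 - V1\<close> for independent \<open>V1 \<sim> L1\<close>, \<open>V2 \<sim> L2\<close>, written as a mixture over \<open>V1\<close>.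
\<close>

definition h :: "real^'n \<Rightarrow> real" where
  "h z = (\<integral>v. MMN_density (- (v *\<^sub>R a)) a (mat (s + t)) L2 z \<partial>interval_measure L1)"

text \<open>
  The variance and the mean of the normal posterior of a centre with observations \<open>x\<close>, \<open>y\<close> of variances
  \<open>s\<close>, \<open>t\<close> under the flat prior.
\<close>

definition r :: real where "r = s * t / (s + t)"
definition m :: "real^'n \<Rightarrow> real^'n \<Rightarrow> real^'n" where
  "m x y = (t / (s + t)) *\<^sub>R x + (s / (s + t)) *\<^sub>R y"

lemma r: "0 < r" "r < s"
  using s t by (auto simp: r_def field_simps)

lemma m_measurable [measurable]:
  assumes "f \<in> borel_measurable M" "g \<in> borel_measurable M"
  shows "(\<lambda>u. m (f u) (g u)) \<in> borel_measurable M"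
  unfolding m_def using assms by measurable

lemma p_measurable [measurable]:
  "f \<in> borel_measurable M \<Longrightarrow> g \<in> borel_measurable M \<Longrightarrow> (\<lambda>u. p (f u) (g u)) \<in> borel_measurable M"
  using L1 s by (rule MMN_density_measurable)

lemma q_measurable [measurable]:
  "f \<in> borel_measurable M \<Longrightarrow> g \<in> borel_measurable M \<Longrightarrow> (\<lambda>u. q (f u) (g u)) \<in> borel_measurable M"
  using L2 t by (rule MMN_density_measurable)

lemma
  shows ennreal_h: "ennreal (h z) =
      (\<integral>\<^sup>+v. (\<integral>\<^sup>+v'. ennreal (gauss (s + t) (z + v *\<^sub>R a - v' *\<^sub>R a)) \<partial>interval_measure L2) \<partial>interval_measure L1)"
    and h_pos: "0 < h z"
proof -
  interpret real_distribution "interval_measure L1"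
    using L1 by (intro is_cdf_real_distribution)
  have st: "s + t > 0" using s t by simp
  have meas: "(\<lambda>v. MMN_density (- (v *\<^sub>R a)) a (mat (s + t)) L2 z) \<in> borel_measurable (interval_measure L1)"
    by (intro MMN_density_measurable[OF L2 st]) auto
  note * = expectation_pos_bounded[OF meas MMN_density_pos MMN_density_le, OF L2 st L2 st]
  show "0 < h z" unfolding h_def by (rule *(2))
  show "ennreal (h z) =
      (\<integral>\<^sup>+v. (\<integral>\<^sup>+v'. ennreal (gauss (s + t) (z + v *\<^sub>R a - v' *\<^sub>R a)) \<partial>interval_measure L2) \<partial>interval_measure L1)"
    unfolding h_def *(1) ennreal_MMN_density[OF L2 st] by simp
qed

lemma h_measurable [measurable]: "h \<in> borel_measurable borel"
proof -
  interpret real_distribution "interval_measure L1"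
    using L1 by (intro is_cdf_real_distribution)
  have [measurable]: "(\<lambda>u. MMN_density (- (snd u *\<^sub>R a)) a (mat (s + t)) L2 (fst u)) \<in> borel_measurable (borel \<Otimes>\<^sub>M interval_measure L1)"
    by (rule MMN_density_measurable[OF L2]) (use s t in \<open>auto intro!: borel_measurable_uminus borel_measurable_scaleR\<close>)
  show ?thesis unfolding h_def by measurable
qed

lemma nn_integral_h: "(\<integral>\<^sup>+y. ennreal (h (y - x)) \<partial>lborel) = 1"
proof -
  interpret A: real_distribution "interval_measure L1"
    using L1 by (intro is_cdf_real_distribution)
  interpret B: real_distribution "interval_measure L2"
    using L2 by (intro is_cdf_real_distribution)
  interpret PA: pair_sigma_finite "interval_measure L1" lborel ..
  interpret PB: pair_sigma_finite "interval_measure L2" lborel ..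
  have st: "s + t > 0" using s t by simp
  have "(\<integral>\<^sup>+y. ennreal (h (y - x)) \<partial>lborel) =
    (\<integral>\<^sup>+v. (\<integral>\<^sup>+y. (\<integral>\<^sup>+v'. ennreal (gauss (s + t) (y - x + v *\<^sub>R a - v' *\<^sub>R a)) \<partial>interval_measure L2) \<partial>lborel) \<partial>interval_measure L1)"
    unfolding ennreal_h by (rule PA.Fubini') measurable
  also have "\<dots> = (\<integral>\<^sup>+v. (\<integral>\<^sup>+v'. (\<integral>\<^sup>+y. ennreal (gauss (s + t) (y - x + v *\<^sub>R a - v' *\<^sub>R a)) \<partial>lborel) \<partial>interval_measure L2) \<partial>interval_measure L1)"
    by (intro nn_integral_cong PB.Fubini') measurable
  also have "\<dots> = (\<integral>\<^sup>+v. (\<integral>\<^sup>+v'. 1 \<partial>interval_measure L2) \<partial>interval_measure L1)"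
    using nn_integral_gauss[OF st, of "x - v *\<^sub>R a + v' *\<^sub>R a" for v v']
    by (simp add: algebra_simps)
  also have "\<dots> = 1" by (simp add: A.emeasure_space_1[simplified] B.emeasure_space_1[simplified])
  finally show ?thesis .
qed

text \<open>
  The marginal of \<open>X\<close> under the prior that is flat on \<open>K\<close>. Mixing drops out since \<open>K\<close> is invariant along
  \<open>a\<close>.
\<close>

lemma nn_integral_prior_predictive:
  assumes [measurable]: "K \<in> sets borel" and K: "\<And>z v. z + v *\<^sub>R a \<in> K \<longleftrightarrow> z \<in> K"
  shows "(\<integral>\<^sup>+z. ennreal (p z x) * indicator K z \<partial>lborel) = ennreal (normal_mass s K x)"
proof -
  interpret A: real_distribution "interval_measure L1"
    using L1 by (intro is_cdf_real_distribution)
  interpret PA: pair_sigma_finite "interval_measure L1" lborel ..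
  have inner: "(\<integral>\<^sup>+z. ennreal (gauss s (x - z - v *\<^sub>R a)) * indicator K z \<partial>lborel) = ennreal (normal_mass s K x)" for v
  proof -
    have "gauss s (x - z - v *\<^sub>R a) = gauss s (z - (x + (- v) *\<^sub>R a))" for z
      using gauss_minus[of s "x - z - v *\<^sub>R a"] by (simp add: algebra_simps del: gauss_minus)
    then show ?thesis
      using normal_mass_shift[OF s assms(1), of "(- v) *\<^sub>R a" x] K[of _ "- v"] s
      by (simp flip: normal_mass_eq)
  qed
  have "(\<integral>\<^sup>+z. ennreal (p z x) * indicator K z \<partial>lborel) =
    (\<integral>\<^sup>+z. (\<integral>\<^sup>+v. ennreal (gauss s (x - z - v *\<^sub>R a)) * indicator K z \<partial>interval_measure L1) \<partial>lborel)"
    using L1 s by (simp add: ennreal_MMN_density nn_integral_multc)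
  also have "\<dots> = (\<integral>\<^sup>+v. (\<integral>\<^sup>+z. ennreal (gauss s (x - z - v *\<^sub>R a)) * indicator K z \<partial>lborel) \<partial>interval_measure L1)"
    by (rule PA.Fubini') measurable
  also have "\<dots> = ennreal (normal_mass s K x)"
    unfolding inner by (simp add: A.emeasure_space_1[simplified])
  finally show ?thesis .
qed

text \<open>
  Given the mixing values, completing the square separates a factor in \<open>y - x\<close> from the mass of \<open>K\<close> under the
  posterior. The mixing values move the posterior mean by a multiple of \<open>a\<close> only, so the second factor is
  the same for all of them and the first mixes to \<open>h\<close>.
\<close>

lemma nn_integral_joint_predictive:
  assumes [measurable]: "K \<in> sets borel" and K: "\<And>z v. z + v *\<^sub>R a \<in> K \<longleftrightarrow> z \<in> K"
  shows "(\<integral>\<^sup>+z. ennreal (q z y) * ennreal (p z x) * indicator K z \<partial>lborel) =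
    ennreal (h (y - x)) * ennreal (normal_mass r K (m x y))"
proof -
  interpret A: real_distribution "interval_measure L1"
    using L1 by (intro is_cdf_real_distribution)
  interpret B: real_distribution "interval_measure L2"
    using L2 by (intro is_cdf_real_distribution)
  interpret PA: pair_sigma_finite "interval_measure L1" lborel ..
  interpret PB: pair_sigma_finite "interval_measure L2" lborel ..
  let ?F = "\<lambda>z v v'. ennreal (gauss t (y - z - v' *\<^sub>R a)) * ennreal (gauss s (x - z - v *\<^sub>R a)) * indicator K z"
  have inner: "(\<integral>\<^sup>+z. ?F z v v' \<partial>lborel) =
      ennreal (gauss (s + t) (y - x + v *\<^sub>R a - v' *\<^sub>R a)) * ennreal (normal_mass r K (m x y))" for v v'
  proof -
    \<comment> \<open>The shift of the posterior mean, in multiples of \<open>a\<close>, when the mixing values \<open>v\<close>, \<open>v'\<close>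
      are subtracted.\<close>
    define c where "c = - (t * v + s * v') / (s + t)"
    have mc: "m (x - v *\<^sub>R a) (y - v' *\<^sub>R a) = m x y + c *\<^sub>R a"
      by (simp add: m_def c_def algebra_simps diff_divide_distrib add_divide_distrib)
    have "gauss t (y - z - v' *\<^sub>R a) * gauss s (x - z - v *\<^sub>R a) =
        gauss (s + t) (y - x + v *\<^sub>R a - v' *\<^sub>R a) * gauss r (z - (m x y + c *\<^sub>R a))" for z
      using gauss_mult_gauss[OF s t, of "x - v *\<^sub>R a" z "y - v' *\<^sub>R a"] gauss_minus[of r "m (x - v *\<^sub>R a) (y - v' *\<^sub>R a) - z"]
      unfolding mc[symmetric] by (simp add: r_def m_def algebra_simps del: gauss_minus)
    then have "?F z v v' = ennreal (gauss (s + t) (y - x + v *\<^sub>R a - v' *\<^sub>R a)) * (ennreal (gauss r (z - (m x y + c *\<^sub>R a))) * indicator K z)" for z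
      using s t r by (simp add: gauss_nonneg ennreal_mult mult.assoc flip: ennreal_mult[of "gauss t u" for u])
    then have "(\<integral>\<^sup>+z. ?F z v v' \<partial>lborel) = ennreal (gauss (s + t) (y - x + v *\<^sub>R a - v' *\<^sub>R a)) * ennreal (normal_mass r K (m x y + c *\<^sub>R a))"
      using r by (simp add: nn_integral_cmult normal_mass_eq)
    then show ?thesis
      using normal_mass_shift[OF r(1) assms(1), of "c *\<^sub>R a" "m x y"] K by simp
  qed
  have "ennreal (q z y) * ennreal (p z x) * indicator K z = (\<integral>\<^sup>+v. (\<integral>\<^sup>+v'. ?F z v v' \<partial>interval_measure L2) \<partial>interval_measure L1)" for z
    using L1 s L2 t by (simp add: ennreal_MMN_density nn_integral_multc nn_integral_cmult)
  then have "(\<integral>\<^sup>+z. ennreal (q z y) * ennreal (p z x) * indicator K z \<partial>lborel) =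
      (\<integral>\<^sup>+z. (\<integral>\<^sup>+v. (\<integral>\<^sup>+v'. ?F z v v' \<partial>interval_measure L2) \<partial>interval_measure L1) \<partial>lborel)"
    by simp
  also have "\<dots> = (\<integral>\<^sup>+v. (\<integral>\<^sup>+z. (\<integral>\<^sup>+v'. ?F z v v' \<partial>interval_measure L2) \<partial>lborel) \<partial>interval_measure L1)"
    by (rule PA.Fubini') measurable
  also have "\<dots> = (\<integral>\<^sup>+v. (\<integral>\<^sup>+v'. (\<integral>\<^sup>+z. ?F z v v' \<partial>lborel) \<partial>interval_measure L2) \<partial>interval_measure L1)"
    by (intro nn_integral_cong PB.Fubini') measurable
  also have "\<dots> = ennreal (h (y - x)) * ennreal (normal_mass r K (m x y))"
    unfolding inner ennreal_h by (simp add: nn_integral_multc)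
  finally show ?thesis .
qed

text \<open>
  The prior is the indicator of a set \<open>S\<close> that agrees almost everywhere with a Borel set \<open>K\<close>; for a convex
  \<open>S\<close>, which may fail to be Borel, \<open>K\<close> can be the closure.
\<close>

lemma bayes_predictive_indicator:
  assumes K[measurable]: "K \<in> sets borel" and inv: "\<And>z v. z + v *\<^sub>R a \<in> K \<longleftrightarrow> z \<in> K"
    and S: "S \<in> sets lebesgue" "AE z in lebesgue. z \<in> S \<longleftrightarrow> z \<in> K"
  shows "bayes_predictive p q (indicator S) x y = h (y - x) * normal_mass r K (m x y) / normal_mass s K x"
proof -
  have [measurable]: "indicator S \<in> borel_measurable (lebesgue :: (real^'n) measure)"
    using S(1) by simp
  have AE: "AE z in lebesgue. (indicator S z :: real) = indicator K z"
    using S(2) by eventually_elim (simp add: indicator_def)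
  have leb: "f \<in> borel_measurable lebesgue" if "f \<in> borel_measurable borel" for f :: "real^'n \<Rightarrow> real"
    using that by (intro measurable_completion) simp
  have [measurable]: "(\<lambda>z. p z x) \<in> borel_measurable lebesgue"
    by (rule leb) measurable
  have [measurable]: "(\<lambda>z. q z y) \<in> borel_measurable lebesgue"
    by (rule leb) measurable
  have [measurable]: "(indicator K :: _ \<Rightarrow> real) \<in> borel_measurable lebesgue"
    by (rule leb) measurable
  have "(\<integral>z. p z x * indicator S z \<partial>lebesgue) = (\<integral>z. p z x * indicator K z \<partial>lebesgue)"
    by (rule integral_cong_AE) (use AE in \<open>auto elim: eventually_mono\<close>)
  also have "\<dots> = (\<integral>z. p z x * indicator K z \<partial>lborel)"
    by (rule integral_completion) measurable
  also have "\<dots> = enn2real (\<integral>\<^sup>+z. ennreal (p z x * indicator K z) \<partial>lborel)"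
    by (rule integral_eq_nn_integral) (use L1 s in \<open>auto simp: MMN_density_pos less_imp_le\<close>)
  also have "(\<integral>\<^sup>+z. ennreal (p z x * indicator K z) \<partial>lborel) = (\<integral>\<^sup>+z. ennreal (p z x) * indicator K z \<partial>lborel)"
    by (intro nn_integral_cong) (simp add: indicator_def)
  also have "\<dots> = ennreal (normal_mass s K x)"
    using K inv by (rule nn_integral_prior_predictive)
  finally have Z: "(\<integral>z. p z x * indicator S z \<partial>lebesgue) = normal_mass s K x"
    by (simp add: normal_mass_nonneg)
  have "(\<integral>z. q z y * (p z x * indicator S z) \<partial>lebesgue) = (\<integral>z. q z y * (p z x * indicator K z) \<partial>lebesgue)"
    by (rule integral_cong_AE) (use AE in \<open>auto elim: eventually_mono\<close>)
  also have "\<dots> = (\<integral>z. q z y * (p z x * indicator K z) \<partial>lborel)"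
    by (rule integral_completion) measurable
  also have "\<dots> = enn2real (\<integral>\<^sup>+z. ennreal (q z y * (p z x * indicator K z)) \<partial>lborel)"
    by (rule integral_eq_nn_integral) (use L1 s L2 t in \<open>auto simp: MMN_density_pos less_imp_le\<close>)
  also have "(\<integral>\<^sup>+z. ennreal (q z y * (p z x * indicator K z)) \<partial>lborel) = (\<integral>\<^sup>+z. ennreal (q z y) * ennreal (p z x) * indicator K z \<partial>lborel)"
    using L2 t L1 s by (intro nn_integral_cong) (simp add: indicator_def ennreal_mult MMN_density_pos less_imp_le)
  also have "\<dots> = ennreal (h (y - x)) * ennreal (normal_mass r K (m x y))"
    using K inv by (rule nn_integral_joint_predictive)
  finally have N: "(\<integral>z. q z y * (p z x * indicator S z) \<partial>lebesgue) = h (y - x) * normal_mass r K (m x y)"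
    using h_pos[of "y - x"] by (simp add: normal_mass_nonneg enn2real_mult less_imp_le)
  show ?thesis
    unfolding bayes_predictive_def posterior_def Z by (simp add: N)
qed

section \<open>Risk comparison\<close>

text \<open>
  The law of the precision-weighted mean of independent \<open>N(\<theta>, s I)\<close> and \<open>N(\<theta>, t I)\<close> variables is
  \<open>N(\<theta>, r I)\<close>. Its variance is again \<open>r\<close>, so the expectation of the numerator of the likelihood ratio is a
  value of \<open>log_loss\<close> at variance \<open>r\<close>.
\<close>

lemma nn_integral_m:
  assumes [measurable]: "f \<in> borel_measurable borel"
  shows "(\<integral>\<^sup>+x. (\<integral>\<^sup>+y. f (m x y) * ennreal (gauss t (y - \<theta>)) \<partial>lborel) * ennreal (gauss s (x - \<theta>)) \<partial>lborel) =
    (\<integral>\<^sup>+w. f w * ennreal (gauss r (w - \<theta>)) \<partial>lborel)"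
proof -
  define c where "c = s / (s + t)"
  let ?f = "\<lambda>w. f w * ennreal (gauss r (w - \<theta>))"
  \<comment> \<open>Substituting \<open>y + x\<close> for \<open>y\<close> makes \<open>m\<close> a translate of \<open>x\<close>, so that the integral over \<open>x\<close> can be done first.\<close>
  have mx: "m x (y + x) = x + c *\<^sub>R y" for x y
  proof -
    have "x = (t / (s + t)) *\<^sub>R x + (s / (s + t)) *\<^sub>R x"
      using s t by (simp flip: scaleR_add_left add_divide_distrib add: add.commute)
    then show ?thesis by (simp add: m_def c_def algebra_simps)
  qed
  have "f (m x y) * ennreal (gauss t (y - \<theta>)) * ennreal (gauss s (x - \<theta>)) = ?f (m x y) * ennreal (gauss (s + t) (y - x))" for x y
  proof -
    have "ennreal (gauss t (y - \<theta>)) * ennreal (gauss s (x - \<theta>)) = ennreal (gauss r (m x y - \<theta>)) * ennreal (gauss (s + t) (y - x))"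
      using gauss_mult_gauss[OF s t, of x \<theta> y] s t r(1)
      by (simp add: gauss_nonneg m_def r_def mult.commute flip: ennreal_mult)
    then show ?thesis by (simp add: mult.assoc)
  qed
  then have "(\<integral>\<^sup>+x. (\<integral>\<^sup>+y. f (m x y) * ennreal (gauss t (y - \<theta>)) \<partial>lborel) * ennreal (gauss s (x - \<theta>)) \<partial>lborel) =
      (\<integral>\<^sup>+x. (\<integral>\<^sup>+y. ?f (m x y) * ennreal (gauss (s + t) (y - x)) \<partial>lborel) \<partial>lborel)"
    by (simp flip: nn_integral_multc)
  also have "\<dots> = (\<integral>\<^sup>+x. (\<integral>\<^sup>+y. ?f (x + c *\<^sub>R y) * ennreal (gauss (s + t) y) \<partial>lborel) \<partial>lborel)"
    using nn_integral_lborel_shift[of "\<lambda>y. ?f (m x y) * ennreal (gauss (s + t) (y - x))" x for x]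
    by (simp add: mx)
  also have "\<dots> = (\<integral>\<^sup>+y. (\<integral>\<^sup>+x. ?f (x + c *\<^sub>R y) * ennreal (gauss (s + t) y) \<partial>lborel) \<partial>lborel)"
    by (rule lborel_pair.Fubini') measurable
  also have "\<dots> = (\<integral>\<^sup>+(y::real^'n). (\<integral>\<^sup>+x. ?f x \<partial>lborel) * ennreal (gauss (s + t) y) \<partial>lborel)"
  proof (rule nn_integral_cong)
    fix y :: "real^'n"
    have "(\<integral>\<^sup>+x. ?f (x + c *\<^sub>R y) * ennreal (gauss (s + t) y) \<partial>lborel) =
        (\<integral>\<^sup>+x. ?f (x + c *\<^sub>R y) \<partial>lborel) * ennreal (gauss (s + t) y)"
      by (rule nn_integral_multc) measurable
    also have "(\<integral>\<^sup>+x. ?f (x + c *\<^sub>R y) \<partial>lborel) = (\<integral>\<^sup>+x. ?f x \<partial>lborel)"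
      by (rule nn_integral_lborel_shift) measurable
    finally show "(\<integral>\<^sup>+x. ?f (x + c *\<^sub>R y) * ennreal (gauss (s + t) y) \<partial>lborel) =
        (\<integral>\<^sup>+x. ?f x \<partial>lborel) * ennreal (gauss (s + t) y)" .
  qed
  also have "\<dots> = (\<integral>\<^sup>+x. ?f x \<partial>lborel)"
    using nn_integral_gauss[of "s + t" "0::real^'n"] s t by (simp add: nn_integral_cmult)
  finally show ?thesis .
qed

lemma mre_predictive_eq: "mre_predictive p q x y = h (y - x)"
  using bayes_predictive_indicator[of UNIV UNIV x y] s r
  by (simp add: mre_predictive_def normal_mass_UNIV indicator_def)

text \<open>
  The integrand and the inner integral of the Kullback-Leibler risk of the MRE density, which predicts
  \<open>h (y - x)\<close>.
\<close>

definition KL_integrand :: "real^'n \<Rightarrow> real^'n \<Rightarrow> real^'n \<Rightarrow> real" where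
  "KL_integrand \<theta> x y = q \<theta> y * ln (q \<theta> y / h (y - x))"

definition KL_loss :: "real^'n \<Rightarrow> real^'n \<Rightarrow> ereal" where
  "KL_loss \<theta> x = ext_integral lborel (\<lambda>y. ereal (KL_integrand \<theta> x y))"

lemma KL_integrand_measurable [measurable]:
  assumes [measurable]: "f \<in> borel_measurable M" "g \<in> borel_measurable M"
  shows "(\<lambda>u. KL_integrand \<theta> (f u) (g u)) \<in> borel_measurable M"
  unfolding KL_integrand_def by measurable

lemma KL_loss_measurable [measurable]: "KL_loss \<theta> \<in> borel_measurable borel"
  unfolding KL_loss_def ext_integral_def by measurable

lemma KL_risk_mre: "KL_risk p q \<theta> (mre_predictive p q) = ext_integral lborel (\<lambda>x. KL_loss \<theta> x * ereal (p \<theta> x))"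
  by (simp add: KL_risk_def ext_integral_lebesgue mre_predictive_eq KL_loss_def KL_integrand_def)

lemma p_pos: "0 < p \<theta> x" and q_pos: "0 < q \<theta> y"
  using MMN_density_pos L1 L2 s t by blast+

lemma nn_integral_p: "(\<integral>\<^sup>+x. ennreal (p \<theta> x) \<partial>lborel) = 1"
  using nn_integral_MMN_density[OF L1 s, of "\<lambda>_. 1" a \<theta>] nn_integral_gauss[OF s, of \<theta>] by simp

lemma nn_integral_q: "(\<integral>\<^sup>+x. ennreal (q \<theta> x) \<partial>lborel) = 1"
  using nn_integral_MMN_density[OF L2 t, of "\<lambda>_. 1" a \<theta>] nn_integral_gauss[OF t, of \<theta>] by simp

text \<open>
  From \<open>ln u \<le> u\<close> with \<open>u = h (y - x) / q \<theta> y\<close>, and \<open>h\<close> is a probability density. This keeps the losses and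
  risks below away from \<open>\<infinity> - \<infinity>\<close>.
\<close>

lemma KL_integrand_neg_part: "(\<integral>\<^sup>+y. ennreal (- KL_integrand \<theta> x y) \<partial>lborel) \<le> 1"
proof -
  have "- KL_integrand \<theta> x y \<le> h (y - x)" for y
  proof -
    have "- ln (q \<theta> y / h (y - x)) = ln (h (y - x) / q \<theta> y)"
      using q_pos[of \<theta> y] h_pos[of "y - x"] by (simp add: ln_div)
    also have "\<dots> \<le> h (y - x) / q \<theta> y"
      using ln_bound[of "h (y - x) / q \<theta> y"] q_pos[of \<theta> y] h_pos[of "y - x"] by simp
    finally have "q \<theta> y * (- ln (q \<theta> y / h (y - x))) \<le> q \<theta> y * (h (y - x) / q \<theta> y)"
      using q_pos[of \<theta> y] by (intro mult_left_mono) auto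
    then show ?thesis using q_pos[of \<theta> y] by (simp add: KL_integrand_def)
  qed
  then have "(\<integral>\<^sup>+y. ennreal (- KL_integrand \<theta> x y) \<partial>lborel) \<le> (\<integral>\<^sup>+y. ennreal (h (y - x)) \<partial>lborel)"
    by (intro nn_integral_mono ennreal_leI)
  then show ?thesis by (simp add: nn_integral_h)
qed

lemma KL_loss_ge: "- 1 \<le> KL_loss \<theta> x"
proof -
  have "- ereal 1 \<le> KL_loss \<theta> x"
    unfolding KL_loss_def using KL_integrand_neg_part[of \<theta> x] by (intro ext_integral_ge) auto
  then show ?thesis by (simp add: one_ereal_def)
qed

lemma KL_risk_mre_neg_part: "(\<integral>\<^sup>+x. e2ennreal (- (KL_loss \<theta> x * ereal (p \<theta> x))) \<partial>lborel) \<le> 1"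
proof -
  have "e2ennreal (- (KL_loss \<theta> x * ereal (p \<theta> x))) \<le> ennreal (p \<theta> x)" for x
  proof (cases "KL_loss \<theta> x")
    case (real u)
    then have "- 1 \<le> u" using KL_loss_ge[of \<theta> x] by (simp add: one_ereal_def)
    then have "- (u * p \<theta> x) \<le> p \<theta> x"
      using mult_right_mono[of "- u" 1 "p \<theta> x"] p_pos[of \<theta> x] by simp
    then show ?thesis using real by (simp add: ennreal_leI)
  next
    case PInf
    then show ?thesis using p_pos[of \<theta> x] by (simp add: e2ennreal_neg)
  next
    case MInf
    then show ?thesis using KL_loss_ge[of \<theta> x] by simp
  qed
  then have "(\<integral>\<^sup>+x. e2ennreal (- (KL_loss \<theta> x * ereal (p \<theta> x))) \<partial>lborel) \<le> (\<integral>\<^sup>+x. ennreal (p \<theta> x) \<partial>lborel)"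
    by (rule nn_integral_mono)
  then show ?thesis by (simp add: nn_integral_p)
qed

lemma KL_risk_mre_ge: "- 1 \<le> KL_risk p q \<theta> (mre_predictive p q)"
proof -
  have "- ereal 1 \<le> KL_risk p q \<theta> (mre_predictive p q)"
    unfolding KL_risk_mre using KL_risk_mre_neg_part[of \<theta>] by (intro ext_integral_ge) auto
  then show ?thesis by (simp add: one_ereal_def)
qed

text \<open>
  The MRE density depends on \<open>y - x\<close> only, so its risk does not change when parameter, observation and
  future value are translated together. Finiteness of the risk at one parameter thus gives it at all.
\<close>

lemma KL_risk_mre_constant:
  "KL_risk p q \<theta> (mre_predictive p q) = KL_risk p q \<theta>' (mre_predictive p q)"
proof -
  define c where "c = \<theta> - \<theta>'"
  have \<theta>: "\<theta> = \<theta>' + c" by (simp add: c_def)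
  have p: "p \<theta> (x + c) = p \<theta>' x" for x
    unfolding \<theta> using s by (rule MMN_density_translate)
  have q: "q \<theta> (y + c) = q \<theta>' y" for y
    unfolding \<theta> using t by (rule MMN_density_translate)
  have "KL_loss \<theta> (x + c) = KL_loss \<theta>' x" for x
    using ext_integral_lborel_shift[of "\<lambda>y. ereal (KL_integrand \<theta> (x + c) y)" c]
    by (simp add: KL_loss_def KL_integrand_def q)
  then show ?thesis
    using ext_integral_lborel_shift[of "\<lambda>x. KL_loss \<theta> x * ereal (p \<theta> x)" c]
    by (simp add: KL_risk_mre p)
qed

text \<open>
  The log ratio of the two predictive densities is \<open>ln (normal_mass r K (m x y)) - ln (normal_mass s K x)\<close>. It is
  constant along \<open>a\<close> in both arguments, so its expectation is the one for Gaussian \<open>X\<close> and \<open>Y\<close>, a difference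
  of two log losses. The identity of risks also holds when the risk of the MRE density is infinite.
\<close>

lemma KL_risk_bayes_indicator:
  assumes K[measurable]: "K \<in> sets borel" and inv: "\<And>z v. z + v *\<^sub>R a \<in> K \<longleftrightarrow> z \<in> K"
    and int: "interior K \<noteq> {}"
    and S: "S \<in> sets lebesgue" "AE z in lebesgue. z \<in> S \<longleftrightarrow> z \<in> K"
  shows "KL_risk p q \<theta> (bayes_predictive p q (indicator S)) =
    KL_risk p q \<theta> (mre_predictive p q) - ereal (enn2real (log_loss s K \<theta>) - enn2real (log_loss r K \<theta>))"
proof -
  define g0 where "g0 x = - ln (normal_mass s K x)" for x
  define g1 where "g1 w = - ln (normal_mass r K w)" for w
  have pos: "0 < normal_mass s K x" "0 < normal_mass r K x" for x
    using s r(1) K int by (auto intro: normal_mass_pos)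
  have g0: "0 \<le> g0 x" and g1: "0 \<le> g1 x" for x
    using pos[of x] normal_mass_le_1[OF s, of K x] normal_mass_le_1[OF r(1), of K x] by (auto simp: g0_def g1_def)
  note [measurable] = normal_mass_measurable[OF s K] normal_mass_measurable[OF r(1) K]
  have [measurable]: "g0 \<in> borel_measurable borel" "g1 \<in> borel_measurable borel"
    unfolding g0_def g1_def by measurable
  have g0_inv: "g0 (x + v *\<^sub>R a) = g0 x" for x v
    using normal_mass_shift[OF s K, of "v *\<^sub>R a" x] inv by (simp add: g0_def)
  have g1_inv: "g1 (x + v *\<^sub>R a) = g1 x" for x v
    using normal_mass_shift[OF r(1) K, of "v *\<^sub>R a" x] inv by (simp add: g1_def)
  have m_y: "m x (y + v *\<^sub>R a) = m x y + (s / (s + t) * v) *\<^sub>R a" for x y v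
    by (simp add: m_def algebra_simps)
  have m_x: "m (x + v *\<^sub>R a) y = m x y + (t / (s + t) * v) *\<^sub>R a" for x y v
    by (simp add: m_def algebra_simps)

  define M1 where "M1 x = (\<integral>\<^sup>+y. ennreal (g1 (m x y)) * ennreal (q \<theta> y) \<partial>lborel)" for x
  have [measurable]: "M1 \<in> borel_measurable borel" unfolding M1_def by measurable
  have M1_gauss: "M1 x = (\<integral>\<^sup>+y. ennreal (g1 (m x y)) * ennreal (gauss t (y - \<theta>)) \<partial>lborel)" for x
    unfolding M1_def by (rule nn_integral_MMN_density[OF L2 t]) (simp_all add: m_y g1_inv)
  have nn0: "(\<integral>\<^sup>+x. ennreal (g0 x) * ennreal (p \<theta> x) \<partial>lborel) = log_loss s K \<theta>"
    unfolding log_loss_def g0_def[symmetric]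
    by (rule nn_integral_MMN_density[OF L1 s]) (simp_all add: g0_inv)
  have "(\<integral>\<^sup>+x. M1 x * ennreal (p \<theta> x) \<partial>lborel) = (\<integral>\<^sup>+x. M1 x * ennreal (gauss s (x - \<theta>)) \<partial>lborel)"
    by (rule nn_integral_MMN_density[OF L1 s]) (simp_all add: M1_def m_x g1_inv)
  also have "\<dots> = log_loss r K \<theta>"
    unfolding M1_gauss log_loss_def g1_def[symmetric] by (rule nn_integral_m) measurable
  finally have nn1: "(\<integral>\<^sup>+x. M1 x * ennreal (p \<theta> x) \<partial>lborel) = log_loss r K \<theta>" .
  have fin: "log_loss s K \<theta> < \<infinity>" "log_loss r K \<theta> < \<infinity>"
    using log_loss_finite[OF s K int] log_loss_finite[OF r(1) K int] by auto

  \<comment> \<open>Integrability in \<open>y\<close> of the second logarithm is inferred for almost every \<open>x\<close>,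
      from the finiteness of the double integral.\<close>
  have good: "AE x in lborel. M1 x < \<infinity>"
  proof -
    have "AE x in lborel. M1 x * ennreal (p \<theta> x) \<noteq> \<infinity>"
      by (rule nn_integral_PInf_AE) (use nn1 fin in auto)
    then show ?thesis
      by eventually_elim (use p_pos[of \<theta>] in \<open>auto simp: ennreal_mult_eq_top_iff ennreal_eq_0_iff less_top not_le[symmetric]\<close>)
  qed

  let ?qC = "bayes_predictive p q (indicator S)"
  have integrand: "q \<theta> y * ln (q \<theta> y / ?qC x y) = KL_integrand \<theta> x y - q \<theta> y * (g0 x - g1 (m x y))" for x y
  proof -
    have "ln (q \<theta> y / ?qC x y) = ln (q \<theta> y / h (y - x)) - (g0 x - g1 (m x y))"
      unfolding bayes_predictive_indicator[OF K inv S] g0_def g1_def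
      using pos[of x] pos[of "m x y"] h_pos[of "y - x"] q_pos[of \<theta> y]
      by (simp add: ln_div ln_mult)
    then show ?thesis by (simp only: KL_integrand_def right_diff_distrib)
  qed
  have loss: "ext_integral lborel (\<lambda>y. ereal (q \<theta> y * ln (q \<theta> y / ?qC x y))) = KL_loss \<theta> x - ereal (g0 x - enn2real (M1 x))"
    if x: "M1 x < \<infinity>" for x
  proof -
    have iq: "integrable lborel (q \<theta>)"
      by (rule integrableI_nonneg) (use q_pos nn_integral_q[of \<theta>] in \<open>auto simp: less_imp_le\<close>)
    have i1: "integrable lborel (\<lambda>y. g1 (m x y) * q \<theta> y)"
      by (rule integrableI_nonneg) (use x q_pos g1 in \<open>auto simp: less_imp_le M1_def ennreal_mult\<close>)
    have "(\<integral>y. q \<theta> y \<partial>lborel) = 1"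
      by (subst integral_eq_nn_integral) (use q_pos nn_integral_q[of \<theta>] in \<open>auto simp: less_imp_le\<close>)
    moreover have "(\<integral>y. g1 (m x y) * q \<theta> y \<partial>lborel) = enn2real (M1 x)"
      by (subst integral_eq_nn_integral) (use q_pos g1 in \<open>auto simp: less_imp_le M1_def ennreal_mult\<close>)
    moreover have eq: "q \<theta> y * (g0 x - g1 (m x y)) = g0 x * q \<theta> y - g1 (m x y) * q \<theta> y" for y
      by (simp add: algebra_simps)
    ultimately have int: "(\<integral>y. q \<theta> y * (g0 x - g1 (m x y)) \<partial>lborel) = g0 x - enn2real (M1 x)"
      unfolding eq using iq i1 by (subst Bochner_Integration.integral_diff) auto
    have "ext_integral lborel (\<lambda>y. ereal (KL_integrand \<theta> x y) - ereal (q \<theta> y * (g0 x - g1 (m x y)))) =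
        ext_integral lborel (\<lambda>y. ereal (KL_integrand \<theta> x y)) - ereal (\<integral>y. q \<theta> y * (g0 x - g1 (m x y)) \<partial>lborel)"
    proof (rule ext_integral_diff)
      show "integrable lborel (\<lambda>y. q \<theta> y * (g0 x - g1 (m x y)))"
        unfolding eq using iq i1 by auto
      have "(\<integral>\<^sup>+y. e2ennreal (- ereal (KL_integrand \<theta> x y)) \<partial>lborel) \<le> 1"
        using KL_integrand_neg_part[of \<theta> x] by simp
      also have "\<dots> < \<infinity>" by simp
      finally show "(\<integral>\<^sup>+y. e2ennreal (- ereal (KL_integrand \<theta> x y)) \<partial>lborel) < \<infinity>" .
    qed measurable
    then show ?thesis unfolding integrand int by (simp add: KL_loss_def)
  qed

  let ?d = "\<lambda>x. g0 x * p \<theta> x - enn2real (M1 x) * p \<theta> x"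
  have i0: "integrable lborel (\<lambda>x. g0 x * p \<theta> x)"
    by (rule integrableI_nonneg) (use fin nn0 p_pos g0 in \<open>auto simp: less_imp_le ennreal_mult\<close>)
  have nn1': "(\<integral>\<^sup>+x. ennreal (enn2real (M1 x) * p \<theta> x) \<partial>lborel) = log_loss r K \<theta>"
    unfolding nn1[symmetric]
    by (rule nn_integral_cong_AE) (use good p_pos in \<open>auto elim!: eventually_mono simp: ennreal_mult less_imp_le\<close>)
  have i1: "integrable lborel (\<lambda>x. enn2real (M1 x) * p \<theta> x)"
    by (rule integrableI_nonneg) (use fin nn1' p_pos in \<open>auto simp: less_imp_le\<close>)
  have int: "(\<integral>x. ?d x \<partial>lborel) = enn2real (log_loss s K \<theta>) - enn2real (log_loss r K \<theta>)"
  proof -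
    have "(\<integral>x. g0 x * p \<theta> x \<partial>lborel) = enn2real (log_loss s K \<theta>)"
      by (subst integral_eq_nn_integral) (use p_pos g0 nn0 in \<open>auto simp: less_imp_le ennreal_mult\<close>)
    moreover have "(\<integral>x. enn2real (M1 x) * p \<theta> x \<partial>lborel) = enn2real (log_loss r K \<theta>)"
      by (subst integral_eq_nn_integral) (use p_pos nn1' in \<open>auto simp: less_imp_le\<close>)
    ultimately show ?thesis using i0 i1 by simp
  qed
  have "KL_risk p q \<theta> ?qC =
      ext_integral lborel (\<lambda>x. ext_integral lborel (\<lambda>y. ereal (q \<theta> y * ln (q \<theta> y / ?qC x y))) * ereal (p \<theta> x))"
    by (simp add: KL_risk_def ext_integral_lebesgue)
  also have "\<dots> = ext_integral lborel (\<lambda>x. KL_loss \<theta> x * ereal (p \<theta> x) - ereal (?d x))"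
  proof (rule ext_integral_cong_AE, use good in eventually_elim)
    fix x assume "M1 x < \<infinity>"
    then show "ext_integral lborel (\<lambda>y. ereal (q \<theta> y * ln (q \<theta> y / ?qC x y))) * ereal (p \<theta> x) =
        KL_loss \<theta> x * ereal (p \<theta> x) - ereal (?d x)"
      using p_pos[of \<theta> x] by (cases "KL_loss \<theta> x") (simp_all add: loss algebra_simps)
  qed
  also have "\<dots> = ext_integral lborel (\<lambda>x. KL_loss \<theta> x * ereal (p \<theta> x)) - ereal (\<integral>x. ?d x \<partial>lborel)"
  proof (rule ext_integral_diff)
    show "integrable lborel ?d" using i0 i1 by auto
    have "(\<integral>\<^sup>+x. e2ennreal (- (KL_loss \<theta> x * ereal (p \<theta> x))) \<partial>lborel) \<le> 1"
      by (rule KL_risk_mre_neg_part)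
    also have "\<dots> < \<infinity>" by simp
    finally show "(\<integral>\<^sup>+x. e2ennreal (- (KL_loss \<theta> x * ereal (p \<theta> x))) \<partial>lborel) < \<infinity>" .
  qed measurable
  finally show ?thesis unfolding int KL_risk_mre .
qed

text \<open>
  The restriction set \<open>S\<close> itself need not be Borel; its closure \<open>K\<close> is, and differs from it in a null set.
\<close>

lemma bayes_indicator_dominates:
  assumes "convex S" "interior S \<noteq> {}" "S \<noteq> UNIV"
    and inv: "\<And>z v. z \<in> S \<Longrightarrow> z + v *\<^sub>R a \<in> S"
    and fin: "KL_risk p q \<theta>0 (mre_predictive p q) < \<infinity>"
  shows "dominates_on S (KL_risk p q) (bayes_predictive p q (indicator S)) (mre_predictive p q)"
proof -
  define K where "K = closure S"
  have SK: "S \<subseteq> K" by (simp add: K_def closure_subset)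
  have K: "convex K" "closed K" "K \<in> sets borel"
    using \<open>convex S\<close> by (auto simp: K_def)
  have iK: "interior K = interior S"
    unfolding K_def using \<open>convex S\<close> by (rule convex_interior_closure)
  have K_UNIV: "K \<noteq> UNIV"
  proof
    assume "K = UNIV"
    then have "interior S = UNIV" using iK by simp
    then show False using \<open>S \<noteq> UNIV\<close> interior_subset[of S] by auto
  qed
  have K_inv: "z + v *\<^sub>R a \<in> K" if "z \<in> K" for z v
  proof -
    have "(\<lambda>z. z + v *\<^sub>R a) ` K \<subseteq> K"
      unfolding K_def by (rule image_closure_subset) (use inv closure_subset in \<open>auto intro!: continuous_intros\<close>)
    then show ?thesis using that by auto
  qed
  have K_iff: "z + v *\<^sub>R a \<in> K \<longleftrightarrow> z \<in> K" for z v
    using K_inv[of z v] K_inv[of "z + v *\<^sub>R a" "- v"] by auto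
  have null: "frontier S \<in> null_sets lebesgue"
    using negligible_convex_frontier[OF \<open>convex S\<close>] by (simp add: negligible_iff_null_sets)
  have "S = interior S \<union> (S - interior S)" using interior_subset by auto
  moreover have "S - interior S \<subseteq> frontier S" using SK by (auto simp: frontier_def K_def)
  then have "S - interior S \<in> sets lebesgue"
    using null by (meson negligible_iff_null_sets negligible_subset null_setsD2)
  ultimately have S: "S \<in> sets lebesgue"
    by (metis sets.Un lborelD borel_open open_interior sets_completionI_sets sets_lborel)
  have AE: "AE z in lebesgue. z \<in> S \<longleftrightarrow> z \<in> K"
    by (rule AE_I'[OF null]) (use SK interior_subset in \<open>auto simp: frontier_def K_def\<close>)
  note risk = KL_risk_bayes_indicator[OF K(3) K_iff _ S AE, unfolded iK, OF assms(2)]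
  have finite: "log_loss s K \<theta> < top" "log_loss r K \<theta> < top" for \<theta>
    using log_loss_finite[OF s K(3), of \<theta>] log_loss_finite[OF r(1) K(3), of \<theta>] assms(2) iK by auto
  show ?thesis
    unfolding dominates_on_def
  proof (intro conjI ballI)
    fix \<theta> assume "\<theta> \<in> S"
    then have "log_loss r K \<theta> \<le> log_loss s K \<theta>"
      using r K SK assms(2) iK by (intro log_loss_mono) auto
    then have "enn2real (log_loss r K \<theta>) \<le> enn2real (log_loss s K \<theta>)"
      using finite by (intro enn2real_mono)
    then show "KL_risk p q \<theta> (bayes_predictive p q (indicator S)) \<le> KL_risk p q \<theta> (mre_predictive p q)"
      unfolding risk by (cases "KL_risk p q \<theta> (mre_predictive p q)") auto
  next
    obtain \<theta> where \<theta>: "\<theta> \<in> interior S" using assms(2) by auto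
    then have "log_loss r K \<theta> < log_loss s K \<theta>"
      using r K K_UNIV iK by (intro log_loss_strict_mono) auto
    then have "enn2real (log_loss r K \<theta>) < enn2real (log_loss s K \<theta>)"
      using finite[of \<theta>] by (simp add: enn2real_less_iff less_top)
    moreover have "KL_risk p q \<theta> (mre_predictive p q) < \<infinity>"
      using fin KL_risk_mre_constant[of \<theta> \<theta>0] by simp
    moreover note KL_risk_mre_ge[of \<theta>]
    ultimately have "KL_risk p q \<theta> (bayes_predictive p q (indicator S)) < KL_risk p q \<theta> (mre_predictive p q)"
      unfolding risk by (cases "KL_risk p q \<theta> (mre_predictive p q)") auto
    then show "\<exists>\<theta>\<in>S. KL_risk p q \<theta> (bayes_predictive p q (indicator S)) < KL_risk p q \<theta> (mre_predictive p q)"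
      using \<theta> interior_subset by blast
  qed
qed

end

section \<open>Restriction of the rotated location\<close>

theorem theorem6:
  fixes a :: "real ^ ('m::finite option)"
    and \<sigma>X \<sigma>Y :: real
    and L1 L2 :: "real \<Rightarrow> real"
    and M :: "real ^ ('m option) \<Rightarrow> 'w measure"
    and X Y :: "'w \<Rightarrow> real ^ ('m option)"
    and p q :: "real ^ ('m option) \<Rightarrow> real ^ ('m option) \<Rightarrow> real"
    and H :: "real ^ ('m option) ^ ('m option)"
    and H2 :: "real ^ ('m option) ^ 'm"
    and C :: "(real ^ 'm) set"
  assumes "CARD('m option) \<ge> 2"
    and "a \<noteq> 0"
    and "\<sigma>X\<^sup>2 > 0" and "\<sigma>Y\<^sup>2 > 0"
    and "is_cdf L1" and "is_cdf L2"
    and "\<And>\<theta>. prob_space (M \<theta>)"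
    and "\<And>\<theta>. prob_space.indep_var (M \<theta>) borel X borel Y"
    and "\<And>\<theta>. distr (M \<theta>) borel X = MMN \<theta> a (mat (\<sigma>X\<^sup>2)) L1"
    and "\<And>\<theta>. distr (M \<theta>) borel Y = MMN \<theta> a (mat (\<sigma>Y\<^sup>2)) L2"
    and "p = (\<lambda>\<theta>. MMN_density \<theta> a (mat (\<sigma>X\<^sup>2)) L1)"
    and "q = (\<lambda>\<theta>. MMN_density \<theta> a (mat (\<sigma>Y\<^sup>2)) L2)"
    and "orthogonal_matrix H"
    and "H $ None = a /\<^sub>R norm a"
    and "\<And>j. H $ Some j = H2 $ j"
    and "convex C" and "interior C \<noteq> {}" and "C \<noteq> UNIV"
    and "\<exists>\<theta>. KL_risk p q \<theta> (mre_predictive p q) < \<infinity>"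
  shows "dominates_on {\<theta>. H2 *v \<theta> \<in> C} (KL_risk p q)
           (bayes_predictive p q (\<lambda>\<theta>. indicator C (H2 *v \<theta>)))
           (mre_predictive p q)"
proof -
  interpret MMN_pair a "\<sigma>X\<^sup>2" "\<sigma>Y\<^sup>2" L1 L2
    using assms by unfold_locales auto
  let ?S = "{\<theta>. H2 *v \<theta> \<in> C}"
  have lin: "linear ((*v) H2)" by (rule matrix_vector_mul_linear)
  have HHt: "H ** transpose H = mat 1"
    using \<open>orthogonal_matrix H\<close> by (simp add: orthogonal_matrix_def)
  have HH: "H $ i \<bullet> H $ j = (if i = j then 1 else 0)" for i j
  proof -
    have "(H ** transpose H) $ i $ j = H $ i \<bullet> H $ j"
      by (simp add: matrix_matrix_mult_def transpose_def inner_vec_def)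
    then show ?thesis unfolding HHt by (simp add: mat_def)
  qed
  have H2a: "H2 *v a = 0"
  proof -
    have "a = norm a *\<^sub>R H $ None" using assms(2,14) by simp
    then have "H2 $ j \<bullet> a = 0" for j
      using HH[of "Some j" None] assms(15)[of j] by (metis inner_scaleR_right mult_zero_right option.distinct(1))
    then show ?thesis by (simp add: vec_eq_iff matrix_vector_mult_def inner_vec_def)
  qed
  have surj: "\<exists>\<theta>. H2 *v \<theta> = c" for c
  proof -
    \<comment> \<open>Row \<open>None\<close> of \<open>H\<close> is the direction \<open>a\<close>, which \<open>H2\<close> does not see; any entry would do there.\<close>
    define b :: "real^('m option)" where "b = (\<chi> i. case i of None \<Rightarrow> 0 | Some j \<Rightarrow> c $ j)"
    have "H *v (transpose H *v b) = b"
      unfolding matrix_vector_mul_assoc HHt by simp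
    then have "(H *v (transpose H *v b)) $ Some j = c $ j" for j
      by (simp add: b_def)
    then have "H2 *v (transpose H *v b) = c"
      using assms(15) by (simp add: vec_eq_iff matrix_vector_mult_def)
    then show ?thesis by blast
  qed
  have "convex ?S"
    using convex_linear_vimage[OF lin \<open>convex C\<close>] by (simp add: vimage_def)
  moreover have "interior ?S \<noteq> {}"
  proof -
    obtain c where "c \<in> interior C" using assms by auto
    then obtain \<theta> where "\<theta> \<in> (*v) H2 -` interior C" using surj[of c] by auto
    moreover have "open ((*v) H2 -` interior C)"
      by (intro open_vimage linear_continuous_on open_interior) (simp add: lin linear_conv_bounded_linear[symmetric])
    moreover have "(*v) H2 -` interior C \<subseteq> ?S" using interior_subset by auto
    ultimately show ?thesis using interior_maximal by blast
  qed
  moreover have "?S \<noteq> UNIV"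
  proof
    assume "?S = UNIV"
    then have "C = UNIV" using surj by (metis UNIV_eq_I UNIV_I mem_Collect_eq)
    then show False using assms by simp
  qed
  moreover have "z + v *\<^sub>R a \<in> ?S" if "z \<in> ?S" for z v
    using that H2a by (simp add: matrix_vector_right_distrib matrix_vector_mult_scaleR)
  moreover obtain \<theta>0 where "KL_risk p q \<theta>0 (mre_predictive p q) < \<infinity>"
    using assms by blast
  moreover have "(\<lambda>\<theta>. indicator C (H2 *v \<theta>) :: real) = indicator ?S"
    by (auto simp: indicator_def)
  ultimately show ?thesis
    using bayes_indicator_dominates[of ?S \<theta>0] unfolding assms(11,12) by simp
qed

end
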